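(* Let $\mathbb F$ be an arbitrary field and let $M(x)=[A(x)\,|\,B(x)]$, $x=(x_1,\dots,x_n)$, be a bipartite matrix ($A(x)$ of size $m\times p$, $B(x)$ of size $m\times q$) in which $n$ entries are the unknowns $x_1,\dots,x_n$ (each occurring in exactly one position) and all the other entries are zero. Represent $M(x)$ by its graph. Among all pairs consisting of a largest left matchbox and a largest right matchbox, choose a pair $(\mathcal A,\mathcal B)$ with the minimal number $v(\mathcal A,\mathcal B)$ of common vertices. Put $$M_{\rm gen}=[A_{\rm gen}\,|\,B_{\rm gen}]=M(\varepsilon_{\mathcal A\cup\mathcal B}),\qquad f(x)=f_{\mathcal A\mathcal B}(x)=\mathrm{LCM}\{\mu_{\mathcal A}(x),\ \mu_{\mathcal B}(x),\ \mu_{\mathcal A\Cup\mathcal B}(x)\}.$$ Then $f$ is a nonzero polynomial; all matrices of the family $\mathcal M_f=\{M(a)\mid a\in\mathbb F^n,\ f(a)\ne0\}$ reduce by transformations $[A\,|\,B]\mapsto[SAR_1\,|\,SBR_2]$, with nonsingular $S,R_1,R_2$ over $\mathbb F$, to the matrix $M_{\rm gen}$; and $M_{\rm gen}\in\mathcal M_f$. Up to a permutation of columns within $A_{\rm gen}$, a permutation of columns within $B_{\rm gen}$, and a permutation of rows of the whole matrix, $M_{\rm gen}=M(\varepsilon_{\mathcal A\cup\mathcal B})$ has the form $$\left[\begin{array}{ccc|ccc} I_r&0&0&0&I_r&0\\ 0&I_s&0&0&0&0\\ 0&0&0&I_t&0&0\\ 0&0&0&0&0&0\end{array}\right],$$ where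 $$r=v(\mathcal A,\mathcal B),\qquad s=\operatorname{size}\mathcal A-r,\qquad t=\operatorname{size}\mathcal B-r,$$ and these numbers satisfy $r+s=r_A$, $r+t=r_B$, $r+s+t=r_M$.
   Context: A bipartite matrix $[A\,|\,B]$ is a block matrix representing a pair $(A,B)$ of matrices with the same number of rows. $I_k$ is the $k\times k$ identity matrix; blocks may be empty. For $a\in\mathbb F^n$, $M(a)=[A(a)\,|\,B(a)]$ is obtained by substituting $a_l$ for $x_l$. With $\mathbb K=\mathbb F(x_1,\dots,x_n)$ the field of rational functions, $r_A=\operatorname{rank}_{\mathbb K}A(x)$, $r_B=\operatorname{rank}_{\mathbb K}B(x)$, $r_M=\operatorname{rank}_{\mathbb K}M(x)$. Graph of $M(x)$: its vertices are $1,\dots,m,\ 1^-,\dots,p^-,\ 1^+,\dots,q^+$ (all distinct). Its edges $\alpha_1,\dots,\alpha_n$ correspond to the unknowns: if $x_l$ is the $(i,j)$ entry of $A(x)$, then $\alpha_l$ joins $i$ and $j^-$ (a left edge); if $x_l$ is the $(i,j)$ entry of $B(x)$, then $\alpha_l$ joins $i$ and $j^+$ (a right edge). For a set $\mathcal S$ of edges, its characteristic vector is $\varepsilon_{\mathcal S}=(e_1,\dots,e_n)$ with $e_l=1$ if $\alpha_l\in\mathcal S$ and $e_l=0$ otherwise. A matchbox is a set of edges (called matches) no two of which have a common vertex; its size is the number of its edges. A matchbox is left (right) if all its edges are left (right). A left (right) matchbox is largest if it has the maximal size among all left (right) matchboxes. For a left matchbox $\mathcal A$ and a right matchbox $\mathcal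 B$, $v(\mathcal A,\mathcal B)$ is the number of vertices that belong both to an edge of $\mathcal A$ and to an edge of $\mathcal B$, and $\mathcal A\Cup\mathcal B$ is the matchbox obtained from $\mathcal A\cup\mathcal B$ by removing all edges of $\mathcal B$ that have a common vertex with an edge of $\mathcal A$. For a matchbox $\mathcal S$ with left edges joining $i_1,\dots,i_\alpha$ to $j_1^-,\dots,j_\alpha^-$ respectively and right edges joining $i_{\alpha+1},\dots,i_{\alpha+\beta}$ to $k_1^+,\dots,k_\beta^+$ respectively, $\mu_{\mathcal S}(x)$ denotes the minor of order $\alpha+\beta$ of $M(x)$ (a polynomial in $\mathbb F[x_1,\dots,x_n]$) whose matrix lies in the rows numbered $i_1,\dots,i_{\alpha+\beta}$, the columns of $A(x)$ numbered $j_1,\dots,j_\alpha$, and the columns of $B(x)$ numbered $k_1,\dots,k_\beta$. The minor of order $0$ (for the empty matchbox) is $1$. LCM denotes the lowest common multiple in $\mathbb F[x_1,\dots,x_n]$ (defined up to a nonzero scalar factor). *)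

theory Defs
  imports
    Jordan_Normal_Form.DL_Rank
    Jordan_Normal_Form.DL_Submatrix
    "HOL-Library.Poly_Mapping"
    "HOL-Computational_Algebra.Fraction_Field"
    "HOL-Combinatorics.Permutations"
begin

section \<open>Polynomials in finitely many unknowns\<close>

text \<open>
  The unknowns are indexed by a finite type \<open>'n\<close>, so that \<open>('n, 'a) mpol\<close> is the ring
  \<open>F[x\<^sub>1, \<dots>, x\<^sub>n]\<close> with \<open>n = CARD('n)\<close>; a polynomial maps exponent vectors to coefficients.
  A linear order on the indices is what the library asks for in order to make this ring an
  integral domain; \<open>('n, 'a) mpol fract\<close> is then the field of rational functions.
\<close>

type_synonym ('n, 'a) mpol = "('n \<Rightarrow>\<^sub>0 nat) \<Rightarrow>\<^sub>0 'a"

definition unknown :: "'n \<Rightarrow> ('n, 'a::zero_neq_one) mpol" where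
  "unknown l = Poly_Mapping.single (Poly_Mapping.single l 1) 1"

definition mpol_eval :: "('n::finite \<Rightarrow> 'a::comm_semiring_1) \<Rightarrow> ('n, 'a) mpol \<Rightarrow> 'a" where
  "mpol_eval a g = (\<Sum>k\<in>Poly_Mapping.keys g.
     Poly_Mapping.lookup g k * (\<Prod>l\<in>UNIV. a l ^ Poly_Mapping.lookup k l))"

text \<open>A lowest common multiple is only determined up to associates, hence a predicate.\<close>

definition is_LCM :: "'r::comm_semiring_1 \<Rightarrow> 'r set \<Rightarrow> bool" where
  "is_LCM f G \<longleftrightarrow> (\<forall>g\<in>G. g dvd f) \<and> (\<forall>h. (\<forall>g\<in>G. g dvd h) \<longrightarrow> f dvd h)"

section \<open>Bipartite matrices\<close>

definition bip_mat :: "'r::zero mat \<Rightarrow> 'r mat \<Rightarrow> 'r mat" where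
  "bip_mat A B = four_block_mat A B (0\<^sub>m 0 (dim_col A)) (0\<^sub>m 0 (dim_col B))"

definition generic_bipartite ::
  "nat \<Rightarrow> nat \<Rightarrow> nat \<Rightarrow> ('n, 'a::zero_neq_one) mpol mat \<Rightarrow> ('n, 'a) mpol mat \<Rightarrow> bool" where
  "generic_bipartite m p q A B \<longleftrightarrow>
     A \<in> carrier_mat m p \<and> B \<in> carrier_mat m q \<and>
     (\<forall>i<m. \<forall>j<p + q. bip_mat A B $$ (i, j) = 0 \<or> (\<exists>l. bip_mat A B $$ (i, j) = unknown l)) \<and>
     (\<forall>l. \<exists>!ij. fst ij < m \<and> snd ij < p + q \<and> bip_mat A B $$ ij = unknown l)"

definition rank_K :: "('n::linorder, 'a::field) mpol mat \<Rightarrow> nat" where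
  "rank_K A = vec_space.rank (dim_row A) (map_mat (\<lambda>g. Fract g 1) A)"

definition bip_subst :: "('n::finite, 'a::comm_semiring_1) mpol mat \<Rightarrow> ('n, 'a) mpol mat \<Rightarrow>
    ('n \<Rightarrow> 'a) \<Rightarrow> 'a mat \<times> 'a mat" where
  "bip_subst A B a = (map_mat (mpol_eval a) A, map_mat (mpol_eval a) B)"

definition bip_family :: "('n::finite, 'a::comm_semiring_1) mpol mat \<Rightarrow> ('n, 'a) mpol mat \<Rightarrow>
    ('n, 'a) mpol \<Rightarrow> ('a mat \<times> 'a mat) set" where
  "bip_family A B f = {bip_subst A B a | a. mpol_eval a f \<noteq> 0}"

definition bip_reduces :: "'a::field mat \<times> 'a mat \<Rightarrow> 'a mat \<times> 'a mat \<Rightarrow> bool" where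
  "bip_reduces M N \<longleftrightarrow> (\<exists>S R1 R2.
     S \<in> carrier_mat (dim_row (fst M)) (dim_row (fst M)) \<and> invertible_mat S \<and>
     R1 \<in> carrier_mat (dim_col (fst M)) (dim_col (fst M)) \<and> invertible_mat R1 \<and>
     R2 \<in> carrier_mat (dim_col (snd M)) (dim_col (snd M)) \<and> invertible_mat R2 \<and>
     N = (S * fst M * R1, S * snd M * R2))"

section \<open>The graph of a bipartite matrix\<close>

text \<open>The vertices \<open>i\<close>, \<open>j\<^sup>-\<close> and \<open>j\<^sup>+\<close>. Rows and columns are counted from 0.\<close>

datatype vertex = Row nat | Minus nat | Plus nat

text \<open>The edges correspond to the unknowns, so an edge is given by the index of its unknown.\<close>

definition left_joins :: "('n, 'a::zero_neq_one) mpol mat \<Rightarrow> 'n \<Rightarrow> nat \<Rightarrow> nat \<Rightarrow> bool" where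
  "left_joins A l i j \<longleftrightarrow> i < dim_row A \<and> j < dim_col A \<and> A $$ (i, j) = unknown l"

definition right_joins :: "('n, 'a::zero_neq_one) mpol mat \<Rightarrow> 'n \<Rightarrow> nat \<Rightarrow> nat \<Rightarrow> bool" where
  "right_joins B l i j \<longleftrightarrow> i < dim_row B \<and> j < dim_col B \<and> B $$ (i, j) = unknown l"

definition ends ::
  "('n, 'a::zero_neq_one) mpol mat \<Rightarrow> ('n, 'a) mpol mat \<Rightarrow> 'n \<Rightarrow> vertex set" where
  "ends A B l = \<Union>{{Row i, Minus j} | i j. left_joins A l i j} \<union>
                \<Union>{{Row i, Plus j} | i j. right_joins B l i j}"

definition verts ::
  "('n, 'a::zero_neq_one) mpol mat \<Rightarrow> ('n, 'a) mpol mat \<Rightarrow> 'n set \<Rightarrow> vertex set" where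
  "verts A B S = (\<Union>l\<in>S. ends A B l)"

definition matchbox ::
  "('n, 'a::zero_neq_one) mpol mat \<Rightarrow> ('n, 'a) mpol mat \<Rightarrow> 'n set \<Rightarrow> bool" where
  "matchbox A B S \<longleftrightarrow> (\<forall>k\<in>S. \<forall>l\<in>S. k \<noteq> l \<longrightarrow> ends A B k \<inter> ends A B l = {})"

definition left_matchbox ::
  "('n, 'a::zero_neq_one) mpol mat \<Rightarrow> ('n, 'a) mpol mat \<Rightarrow> 'n set \<Rightarrow> bool" where
  "left_matchbox A B S \<longleftrightarrow> matchbox A B S \<and> (\<forall>l\<in>S. \<exists>i j. left_joins A l i j)"

definition right_matchbox ::
  "('n, 'a::zero_neq_one) mpol mat \<Rightarrow> ('n, 'a) mpol mat \<Rightarrow> 'n set \<Rightarrow> bool" where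
  "right_matchbox A B S \<longleftrightarrow> matchbox A B S \<and> (\<forall>l\<in>S. \<exists>i j. right_joins B l i j)"

definition largest_left ::
  "('n, 'a::zero_neq_one) mpol mat \<Rightarrow> ('n, 'a) mpol mat \<Rightarrow> 'n set \<Rightarrow> bool" where
  "largest_left A B S \<longleftrightarrow> left_matchbox A B S \<and> (\<forall>T. left_matchbox A B T \<longrightarrow> card T \<le> card S)"

definition largest_right ::
  "('n, 'a::zero_neq_one) mpol mat \<Rightarrow> ('n, 'a) mpol mat \<Rightarrow> 'n set \<Rightarrow> bool" where
  "largest_right A B S \<longleftrightarrow> right_matchbox A B S \<and> (\<forall>T. right_matchbox A B T \<longrightarrow> card T \<le> card S)"

definition common_verts ::
  "('n, 'a::zero_neq_one) mpol mat \<Rightarrow> ('n, 'a) mpol mat \<Rightarrow> 'n set \<Rightarrow> 'n set \<Rightarrow> nat" where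
  "common_verts A B S T = card (verts A B S \<inter> verts A B T)"

definition optimal_pair ::
  "('n, 'a::zero_neq_one) mpol mat \<Rightarrow> ('n, 'a) mpol mat \<Rightarrow> 'n set \<Rightarrow> 'n set \<Rightarrow> bool" where
  "optimal_pair A B S T \<longleftrightarrow> largest_left A B S \<and> largest_right A B T \<and>
     (\<forall>S' T'. largest_left A B S' \<longrightarrow> largest_right A B T' \<longrightarrow>
        common_verts A B S T \<le> common_verts A B S' T')"

definition merge ::
  "('n, 'a::zero_neq_one) mpol mat \<Rightarrow> ('n, 'a) mpol mat \<Rightarrow> 'n set \<Rightarrow> 'n set \<Rightarrow> 'n set" where
  "merge A B S T = (S \<union> T) - {l\<in>T. \<exists>k\<in>S. ends A B k \<inter> ends A B l \<noteq> {}}"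

text \<open>
  The minor of a matchbox. Its rows and columns are taken in increasing order; any other order
  changes at most the sign, which an LCM does not see.
\<close>

definition mu ::
  "('n, 'a::comm_ring_1) mpol mat \<Rightarrow> ('n, 'a) mpol mat \<Rightarrow> 'n set \<Rightarrow> ('n, 'a) mpol" where
  "mu A B S = det (submatrix (bip_mat A B)
     {i. Row i \<in> verts A B S}
     ({j. Minus j \<in> verts A B S} \<union> {dim_col A + j | j. Plus j \<in> verts A B S}))"

definition char_vec :: "'n set \<Rightarrow> 'n \<Rightarrow> 'a::zero_neq_one" where
  "char_vec S l = (if l \<in> S then 1 else 0)"

section \<open>The canonical form\<close>

text \<open>
  The row strips have heights \<open>r, s, t, m - r - s - t\<close>. The columns of the left block are split as
  \<open>r, s, p - r - s\<close>, and the identities \<open>I\<^sub>r\<close>, \<open>I\<^sub>s\<close> lie in row strips 1, 2. The columns of the right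
  block are split as \<open>t, r, q - r - t\<close>: the first part has \<open>I\<^sub>t\<close> in row strip 3, the second has
  \<open>I\<^sub>r\<close> in row strip 1.
\<close>

definition canonical_left :: "nat \<Rightarrow> nat \<Rightarrow> nat \<Rightarrow> nat \<Rightarrow> 'a::zero_neq_one mat" where
  "canonical_left m p r s = mat m p (\<lambda>(i, j). if i = j \<and> j < r + s then 1 else 0)"

definition canonical_right ::
  "nat \<Rightarrow> nat \<Rightarrow> nat \<Rightarrow> nat \<Rightarrow> nat \<Rightarrow> 'a::zero_neq_one mat" where
  "canonical_right m q r s t = mat m q (\<lambda>(i, j).
     if (j < t \<and> i = r + s + j) \<or> (t \<le> j \<and> j < t + r \<and> t + i = j) then 1 else 0)"

definition permute_mat :: "(nat \<Rightarrow> nat) \<Rightarrow> (nat \<Rightarrow> nat) \<Rightarrow> 'a mat \<Rightarrow> 'a mat" where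
  "permute_mat \<rho> \<sigma> A = mat (dim_row A) (dim_col A) (\<lambda>(i, j). A $$ (\<rho> i, \<sigma> j))"

definition canonical_up_to_perm ::
  "nat \<Rightarrow> nat \<Rightarrow> nat \<Rightarrow> nat \<Rightarrow> nat \<Rightarrow> nat \<Rightarrow> 'a::zero_neq_one mat \<times> 'a mat \<Rightarrow> bool" where
  "canonical_up_to_perm m p q r s t N \<longleftrightarrow>
     r + s + t \<le> m \<and> r + s \<le> p \<and> r + t \<le> q \<and>
     (\<exists>\<rho> \<sigma> \<tau>. \<rho> permutes {..<m} \<and> \<sigma> permutes {..<p} \<and> \<tau> permutes {..<q} \<and>
        permute_mat \<rho> \<sigma> (fst N) = canonical_left m p r s \<and>
        permute_mat \<rho> \<tau> (snd N) = canonical_right m q r s t)"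

end

theory Submission
  imports
    Defs
    "Jordan_Normal_Form.Column_Operations"
begin

text \<open>
  Two pairs \<open>(A, B)\<close> of constant matrices of the same sizes are equivalent as soon as the ranks of
  \<open>A\<close>, \<open>B\<close> and \<open>[A|B]\<close> agree, because Gaussian elimination brings every pair to the canonical
  form and these three ranks determine its parameters. It remains to compute the ranks wherever the
  three minors do not vanish, be it at a point of \<open>F\<^sup>n\<close> or over the field of rational functions.
  The minors bound the ranks from below. Conversely, a nonzero minor of order \<open>k\<close> has a nonzero term
  in its Leibniz expansion, which is a matchbox of size \<open>k\<close>; hence the ranks of \<open>A\<close> and \<open>B\<close> are at
  most the sizes of largest left and right matchboxes. An arbitrary matchbox \<open>U\<close> consists of a left
  and a right matchbox, which can be enlarged to largest ones \<open>S'\<close>, \<open>T'\<close> without giving up any of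
  the rows they cover; so \<open>|U|\<close> is at most \<open>|S'| + |T'| - v(S', T')\<close>, and this is where the
  minimality of \<open>v\<close> enters.
\<close>

section \<open>Evaluation of polynomials\<close>

text \<open>The field may be finite, so a nonzero polynomial may vanish at every point. Hence
  neither \<open>f \<noteq> 0\<close> nor the membership of \<open>M_gen\<close> in the family can
  come from a generic choice of point, and ranks over the rational functions cannot be read off from
  ranks at points. Both facts about \<open>f\<close> are obtained at one explicit point, the
  characteristic vector of \<open>\<A> \<union> \<B>\<close>, where each of the three minors is the
  determinant of a permutation matrix. The rank computation is done once for an arbitrary ring
  homomorphism into a field, to be specialized to evaluation at a point and to the embedding into
  the fraction field. The LCM enters only through divisibility: the minors divide \<open>f\<close>,
  and \<open>f\<close> divides their product. A left and a right edge have different column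
  vertices, so common vertices are always rows. This is why an enlargement of a matchbox must
  preserve its rows but may lose columns, and why the rank of the whole matrix can be bounded by
  counting rows.\<close>

lemma mpol_eval_supset:
  assumes "finite K" "Poly_Mapping.keys g \<subseteq> K"
  shows "mpol_eval a g = (\<Sum>k\<in>K. Poly_Mapping.lookup g k * (\<Prod>l\<in>UNIV. a l ^ Poly_Mapping.lookup k l))"
  unfolding mpol_eval_def
  by (rule sum.mono_neutral_left) (use assms in \<open>auto simp: in_keys_iff\<close>)

lemma mpol_eval_single:
  "mpol_eval a (Poly_Mapping.single k c) = c * (\<Prod>l\<in>UNIV. a l ^ Poly_Mapping.lookup k l)"
  by (subst mpol_eval_supset[of "{k}"]) auto

lemma mpol_eval_unknown [simp]: "mpol_eval a (unknown l) = a l"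
proof -
  have "(\<Prod>l'\<in>UNIV. a l' ^ Poly_Mapping.lookup (Poly_Mapping.single l (1::nat)) l')
      = (\<Prod>l'\<in>UNIV. if l' = l then a l' else 1)"
    by (rule prod.cong) (auto simp: lookup_single when_def)
  then show ?thesis
    by (simp add: unknown_def mpol_eval_single)
qed

lemma mpol_eval_0 [simp]: "mpol_eval a 0 = 0"
  by (simp add: mpol_eval_def)

lemma mpol_eval_1 [simp]: "mpol_eval a 1 = 1"
  using mpol_eval_single[of a 0 1] by simp

lemma mpol_eval_add: "mpol_eval a (g + h) = mpol_eval a g + mpol_eval a h"
proof -
  let ?K = "Poly_Mapping.keys g \<union> Poly_Mapping.keys h"
  have "Poly_Mapping.keys (g + h) \<subseteq> ?K" by (rule keys_add)
  then show ?thesis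
    by (subst (1 2 3) mpol_eval_supset[of ?K])
       (auto simp: lookup_add distrib_right sum.distrib)
qed

lemma mpol_eval_sum: "mpol_eval a (\<Sum>i\<in>I. g i) = (\<Sum>i\<in>I. mpol_eval a (g i))"
  by (induction I rule: infinite_finite_induct) (auto simp: mpol_eval_add)

lemma poly_mapping_sum_singles:
  "g = (\<Sum>k\<in>Poly_Mapping.keys g. Poly_Mapping.single k (Poly_Mapping.lookup g k))"
  by (rule poly_mapping_eqI) (auto simp: lookup_sum lookup_single when_def sum.delta in_keys_iff)

lemma mpol_eval_mult:
  fixes g h :: "('n::finite, 'a::comm_semiring_1) mpol"
  shows "mpol_eval a (g * h) = mpol_eval a g * mpol_eval a h"
proof -
  let ?s = "\<lambda>(f :: ('n, 'a) mpol) k. Poly_Mapping.single k (Poly_Mapping.lookup f k)"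
  have single: "mpol_eval a (Poly_Mapping.single k c * Poly_Mapping.single k' c')
      = mpol_eval a (Poly_Mapping.single k c) * mpol_eval a (Poly_Mapping.single k' c')" for k k' c c'
    by (simp add: mult_single mpol_eval_single lookup_add power_add prod.distrib mult_ac)
  have "g * h = (\<Sum>k\<in>Poly_Mapping.keys g. ?s g k) * (\<Sum>k\<in>Poly_Mapping.keys h. ?s h k)"
    by (simp only: poly_mapping_sum_singles[symmetric])
  also have "mpol_eval a \<dots> = mpol_eval a (\<Sum>k\<in>Poly_Mapping.keys g. ?s g k)
      * mpol_eval a (\<Sum>k\<in>Poly_Mapping.keys h. ?s h k)"
    by (simp add: sum_product mpol_eval_sum single)
  also have "\<dots> = mpol_eval a g * mpol_eval a h"
    by (simp only: poly_mapping_sum_singles[symmetric])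
  finally show ?thesis .
qed

lemma comm_ring_hom_mpol_eval: "comm_ring_hom (mpol_eval (a :: 'n::finite \<Rightarrow> 'a::comm_ring_1))"
  by unfold_locales (auto simp: mpol_eval_add mpol_eval_mult)

lemma comm_ring_hom_Fract: "comm_ring_hom (\<lambda>g :: 'r::idom. Fract g 1)"
  by unfold_locales (auto simp: Zero_fract_def One_fract_def)

lemma unknown_eq_iff [simp]: "(unknown k :: ('n, 'a::zero_neq_one) mpol) = unknown l \<longleftrightarrow> k = l"
proof
  assume "(unknown k :: ('n, 'a) mpol) = unknown l"
  then have "Poly_Mapping.keys (unknown k :: ('n, 'a) mpol) = Poly_Mapping.keys (unknown l :: ('n, 'a) mpol)"
    by simp
  then have "Poly_Mapping.single k (1::nat) = Poly_Mapping.single l 1"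
    by (simp add: unknown_def)
  then have "Poly_Mapping.keys (Poly_Mapping.single k (1::nat)) = Poly_Mapping.keys (Poly_Mapping.single l (1::nat))"
    by simp
  then show "k = l" by simp
qed simp

text \<open>Serves both sides of the LCM: from \<open>f\<close> down to the minors, and from the
  product of the minors down to \<open>f\<close>.\<close>

lemma mpol_eval_nonzero_if_dvd:
  "g dvd h \<Longrightarrow> mpol_eval a h \<noteq> 0 \<Longrightarrow> mpol_eval a g \<noteq> 0"
  by (auto simp: mpol_eval_mult elim!: dvdE)

section \<open>Rank and minors\<close>

text \<open>A maximal independent set of columns spans all columns, so the columns picked by
  \<open>g\<close> form the left factor of a full rank factorization. The factorization yields the
  upper bounds on ranks below, and the fact that its left factor consists of columns of
  \<open>N\<close> yields nonzero minors.\<close>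

lemma (in vec_space) rank_factor:
  assumes N: "N \<in> carrier_mat n nc"
  obtains g Y where "inj_on g {..<rank N}" "g ` {..<rank N} \<subseteq> {..<nc}"
    "Y \<in> carrier_mat (rank N) nc" "N = mat n (rank N) (\<lambda>(i, j). N $$ (i, g j)) * Y"
    "rank (mat n (rank N) (\<lambda>(i, j). N $$ (i, g j))) = rank N"
    "distinct (cols (mat n (rank N) (\<lambda>(i, j). N $$ (i, g j))))"
    "lin_indpt (set (cols (mat n (rank N) (\<lambda>(i, j). N $$ (i, g j)))))"
proof -
  let ?P = "\<lambda>T. T \<subseteq> set (cols N) \<and> lin_indpt T"
  have C: "set (cols N) \<subseteq> carrier_vec n" using cols_dim[of N] N by auto
  have "lin_indpt {}" by (simp add: lin_dep_def)
  then obtain U where fin: "finite U" and max: "maximal U ?P"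
    using maximal_exists_superset[of "set (cols N)" ?P "{}"] by blast
  have U: "U \<subseteq> set (cols N)" "lin_indpt U" using max by (auto simp: maximal_def)
  have rk: "rank N = card U" by (rule rank_card_indpt[OF N max])
  have span: "set (cols N) \<subseteq> span U"
  proof
    fix s assume s: "s \<in> set (cols N)"
    show "s \<in> span U"
    proof (rule ccontr)
      assume ns: "s \<notin> span U"
      have UC: "U \<subseteq> carrier_vec n" using U C by auto
      have sC: "s \<in> carrier_vec n" using s C by auto
      have nsU: "s \<notin> U" using ns UC span_mem by auto
      have "lin_indpt (insert s U)"
        using lin_dep_iff_in_span[of U s] UC sC U(2) nsU ns by auto
      then have "?P (insert s U)" using s U by auto
      then have "insert s U = U" using max unfolding maximal_def by blast
      then show False using nsU by auto
    qed
  qed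
  obtain xs where xs: "distinct xs" "set xs = U" "length xs = card U"
    using fin by (metis finite_distinct_list distinct_card)
  let ?k = "rank N"
  have "\<forall>j<?k. \<exists>c<nc. col N c = xs ! j"
  proof (intro allI impI)
    fix j assume "j < ?k"
    then have "xs ! j \<in> set (cols N)" using xs U rk by (metis nth_mem subset_eq)
    then show "\<exists>c<nc. col N c = xs ! j" using N by (auto simp: cols_def)
  qed
  then obtain g where g: "\<And>j. j < ?k \<Longrightarrow> g j < nc \<and> col N (g j) = xs ! j" by metis
  let ?X = "mat n ?k (\<lambda>(i, j). N $$ (i, g j))"
  have X: "?X \<in> carrier_mat n ?k" by simp
  have colX: "col ?X j = xs ! j" if "j < ?k" for j
  proof -
    have gj: "g j < nc" using g that by simp
    have "col ?X j = col N (g j)"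
      by (rule eq_vecI) (use that gj N in auto)
    then show ?thesis using g that by simp
  qed
  have colsX: "cols ?X = xs"
    by (rule nth_equalityI) (use colX xs rk in auto)
  have inj: "inj_on g {..<?k}"
    by (rule inj_onI) (metis g lessThan_iff nth_eq_iff_index_eq rk xs(1,3))
  have "\<exists>y. y \<in> carrier_vec ?k \<and> ?X *\<^sub>v y = col N c" if c: "c < nc" for c
  proof -
    have "col N c \<in> set (cols N)" using c N by (auto simp: cols_def)
    then have "col N c \<in> col_space ?X" using span xs colsX unfolding col_space_def by auto
    then show ?thesis using col_space_eq[OF X] by auto
  qed
  then obtain y where y: "\<And>c. c < nc \<Longrightarrow> y c \<in> carrier_vec ?k \<and> ?X *\<^sub>v y c = col N c" by metis
  define Y where "Y = mat ?k nc (\<lambda>(i, c). y c $ i)"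
  have "N = ?X * Y"
  proof (rule eq_matI)
    fix i c assume "i < dim_row (?X * Y)" "c < dim_col (?X * Y)"
    then have ic: "i < n" "c < nc" by (auto simp: Y_def)
    have "col Y c = y c" by (rule eq_vecI) (use ic y[of c] in \<open>auto simp: Y_def\<close>)
    then have "(?X * Y) $$ (i, c) = (?X *\<^sub>v y c) $ i" using ic by (simp add: Y_def)
    then show "N $$ (i, c) = (?X * Y) $$ (i, c)" using y ic N by simp
  qed (use N in \<open>auto simp: Y_def\<close>)
  moreover have "rank ?X = ?k"
    by (rule lin_indpt_full_rank[OF X]) (use colsX xs U in auto)
  ultimately show ?thesis
    using that[of g Y] inj g colsX xs U by (auto simp: Y_def)
qed

text \<open>Padding \<open>Y\<close> with zero rows gives a singular square matrix, and a kernel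
  vector of it is one of \<open>Y\<close>.\<close>

lemma exists_kernel_vec:
  fixes Y :: "'a::field mat"
  assumes Y: "Y \<in> carrier_mat k r" and "k < r"
  shows "\<exists>v. v \<in> carrier_vec r \<and> v \<noteq> 0\<^sub>v r \<and> Y *\<^sub>v v = 0\<^sub>v k"
proof -
  define Z where "Z = mat r r (\<lambda>(i, j). if i < k then Y $$ (i, j) else 0)"
  have Z: "Z \<in> carrier_mat r r" by (simp add: Z_def)
  \<comment> \<open>Row \<open>k\<close> of \<open>Z\<close> exists because \<open>k < r\<close>,
    and it is zero already; overwriting it by zero only displays \<open>Z\<close> in the form that
    \<open>det_row_0\<close> speaks about.\<close>
  have "Z = mat\<^sub>r r r (\<lambda>i. if i = k then 0\<^sub>v r else row Z i)"
    by (rule eq_matI) (auto simp: Z_def)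
  moreover have "det (mat\<^sub>r r r (\<lambda>i. if i = k then 0\<^sub>v r else row Z i)) = 0"
    by (rule det_row_0) (use \<open>k < r\<close> Z in auto)
  ultimately have "det Z = 0" by simp
  then obtain v where v: "v \<in> carrier_vec r" "v \<noteq> 0\<^sub>v r" "Z *\<^sub>v v = 0\<^sub>v r"
    using det_0_iff_vec_prod_zero[OF Z] by auto
  have "Y *\<^sub>v v = 0\<^sub>v k"
  proof (rule eq_vecI)
    fix i assume "i < dim_vec (0\<^sub>v k)"
    then have i: "i < k" by simp
    have "row Z i = row Y i" by (rule eq_vecI) (use assms i in \<open>auto simp: Z_def\<close>)
    then have "(Y *\<^sub>v v) $ i = (Z *\<^sub>v v) $ i" using i assms Z by simp
    then show "(Y *\<^sub>v v) $ i = 0\<^sub>v k $ i" using v i assms by simp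
  qed (use assms in auto)
  then show ?thesis using v by auto
qed

text \<open>If the rank exceeded \<open>k\<close>, that many independent columns of
  \<open>X * Y\<close> would form a product \<open>X * Y'\<close> in which \<open>Y'\<close> has
  more columns than rows; a kernel vector of \<open>Y'\<close> is then a linear dependence among
  them.\<close>

lemma rank_mult_le_inner:
  fixes X :: "'a::field mat"
  assumes X: "X \<in> carrier_mat m k" and Y: "Y \<in> carrier_mat k n"
  shows "vec_space.rank m (X * Y) \<le> k"
proof (rule ccontr)
  interpret vec_space "TYPE('a)" m .
  let ?N = "X * Y" and ?r = "rank (X * Y)"
  assume "\<not> ?r \<le> k"
  then have kr: "k < ?r" by simp
  have N: "?N \<in> carrier_mat m n" using X Y by simp
  obtain g where g: "g ` {..<?r} \<subseteq> {..<n}"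
    and D: "distinct (cols (mat m ?r (\<lambda>(i, j). ?N $$ (i, g j))))"
    and L: "lin_indpt (set (cols (mat m ?r (\<lambda>(i, j). ?N $$ (i, g j)))))"
    using rank_factor[OF N] by metis
  let ?X = "mat m ?r (\<lambda>(i, j). ?N $$ (i, g j))"
  define Y' where "Y' = mat k ?r (\<lambda>(i, j). Y $$ (i, g j))"
  have Y': "Y' \<in> carrier_mat k ?r" by (simp add: Y'_def)
  have XY: "?X = X * Y'"
  proof (rule eq_matI)
    fix i j assume ij: "i < dim_row (X * Y')" "j < dim_col (X * Y')"
    then have gj: "g j < n" using g Y' by auto
    have "col Y (g j) = col Y' j" by (rule eq_vecI) (use ij gj Y Y' in \<open>auto simp: Y'_def\<close>)
    then show "?X $$ (i, j) = (X * Y') $$ (i, j)" using ij gj X Y Y' by simp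
  qed (use X Y' in auto)
  obtain v where v: "v \<in> carrier_vec ?r" "v \<noteq> 0\<^sub>v ?r" "Y' *\<^sub>v v = 0\<^sub>v k"
    using exists_kernel_vec[OF Y' kr] by auto
  have "?X *\<^sub>v v = 0\<^sub>v m" 
    unfolding XY assoc_mult_mat_vec[OF X Y' v(1)] v(3) by (rule eq_vecI) (use X in auto)
  then show False using lin_depI[of ?X ?r v] v D L by auto
qed

lemma rank_factorization:
  fixes N :: "'a::field mat"
  assumes "N \<in> carrier_mat m n"
  obtains P Q where "P \<in> carrier_mat m (vec_space.rank m N)"
    "Q \<in> carrier_mat (vec_space.rank m N) n" "N = P * Q"
proof -
  obtain g Y where "Y \<in> carrier_mat (vec_space.rank m N) n"
    "N = mat m (vec_space.rank m N) (\<lambda>(i, j). N $$ (i, g j)) * Y"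
    using vec_space.rank_factor[OF assms] by metis
  then show ?thesis using that[OF mat_carrier] by blast
qed

text \<open>Factor one of the matrices through its rank and regroup, so that this rank becomes the
  inner dimension of the product.\<close>

lemma rank_mult_le:
  fixes X :: "'a::field mat"
  assumes X: "X \<in> carrier_mat m k" and Y: "Y \<in> carrier_mat k n"
  shows "vec_space.rank m (X * Y) \<le> vec_space.rank m X"
    and "vec_space.rank m (X * Y) \<le> vec_space.rank k Y"
proof -
  let ?a = "vec_space.rank m X" and ?b = "vec_space.rank k Y"
  obtain P Q where PQ: "P \<in> carrier_mat m ?a" "Q \<in> carrier_mat ?a k" "X = P * Q"
    by (rule rank_factorization[OF X])
  have "X * Y = P * (Q * Y)" unfolding PQ(3) by (rule assoc_mult_mat[OF PQ(1,2) Y])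
  then show "vec_space.rank m (X * Y) \<le> ?a"
    using rank_mult_le_inner[OF PQ(1) mult_carrier_mat[OF PQ(2) Y]] by simp
  obtain P Q where PQ: "P \<in> carrier_mat k ?b" "Q \<in> carrier_mat ?b n" "Y = P * Q"
    by (rule rank_factorization[OF Y])
  have "X * Y = X * P * Q" unfolding PQ(3) by (rule assoc_mult_mat[OF X PQ(1,2), symmetric])
  then show "vec_space.rank m (X * Y) \<le> ?b"
    using rank_mult_le_inner[OF mult_carrier_mat[OF X PQ(1)] PQ(2)] by simp
qed

text \<open>Transposing a factorization keeps its inner dimension; applied to \<open>N\<close> and
  to its transpose, this gives both inequalities.\<close>

lemma rank_transpose:
  fixes N :: "'a::field mat"
  assumes N: "N \<in> carrier_mat m n"
  shows "vec_space.rank n (transpose_mat N) = vec_space.rank m N"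
proof -
  have le: "vec_space.rank c (transpose_mat M) \<le> vec_space.rank r M" if M: "M \<in> carrier_mat r c"
    for r c and M :: "'a mat"
  proof -
    let ?a = "vec_space.rank r M"
    obtain P Q where PQ: "P \<in> carrier_mat r ?a" "Q \<in> carrier_mat ?a c" "M = P * Q"
      by (rule rank_factorization[OF M])
    have "transpose_mat M = transpose_mat Q * transpose_mat P"
      using PQ by (metis transpose_mult)
    then show ?thesis using rank_mult_le_inner[of "transpose_mat Q" c ?a "transpose_mat P" r] PQ by simp
  qed
  show ?thesis using le[OF N] le[of "transpose_mat N" n m] N by simp
qed

text \<open>A submatrix inherits a factorization: take the chosen rows of \<open>P\<close> and the
  chosen columns of \<open>Q\<close>. Index maps instead of index sets allow rows and columns to be
  listed in any convenient order.\<close>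

lemma minor_imp_le_rank:
  fixes N :: "'a::field mat"
  assumes N: "N \<in> carrier_mat m n" and f: "f ` {..<k} \<subseteq> {..<m}" and g: "g ` {..<k} \<subseteq> {..<n}"
    and det: "det (mat k k (\<lambda>(i, j). N $$ (f i, g j))) \<noteq> 0"
  shows "k \<le> vec_space.rank m N"
proof -
  let ?M = "mat k k (\<lambda>(i, j). N $$ (f i, g j))" and ?a = "vec_space.rank m N"
  obtain P Q where PQ: "P \<in> carrier_mat m ?a" "Q \<in> carrier_mat ?a n" "N = P * Q"
    by (rule rank_factorization[OF N])
  define P' where "P' = mat k ?a (\<lambda>(i, j). P $$ (f i, j))"
  define Q' where "Q' = mat ?a k (\<lambda>(i, j). Q $$ (i, g j))"
  have "?M = P' * Q'"
  proof (rule eq_matI)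
    fix i j assume "i < dim_row (P' * Q')" "j < dim_col (P' * Q')"
    then have ij: "i < k" "j < k" "f i < m" "g j < n" using f g by (auto simp: P'_def Q'_def)
    have "row P (f i) = row P' i" "col Q (g j) = col Q' j"
      by (rule eq_vecI; use ij PQ(1,2) in \<open>auto simp: P'_def Q'_def\<close>)+
    moreover have "N $$ (f i, g j) = row P (f i) \<bullet> col Q (g j)"
      by (subst PQ(3)) (use ij PQ(1,2) in auto)
    ultimately show "?M $$ (i, j) = (P' * Q') $$ (i, j)" using ij by (simp add: P'_def Q'_def)
  qed (auto simp: P'_def Q'_def)
  then have "vec_space.rank k ?M \<le> ?a"
    using rank_mult_le_inner[of P' k ?a Q' k] by (simp add: P'_def Q'_def)
  then show ?thesis using vec_space.low_rank_det_zero[of ?M k] det by simp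
qed

text \<open>Select independent columns, transpose, and select independent columns again.\<close>

lemma exists_minor:
  fixes N :: "'a::field mat"
  assumes N: "N \<in> carrier_mat m n"
  defines "k \<equiv> vec_space.rank m N"
  obtains f g where "inj_on f {..<k}" "inj_on g {..<k}" "f ` {..<k} \<subseteq> {..<m}" "g ` {..<k} \<subseteq> {..<n}"
    "det (mat k k (\<lambda>(i, j). N $$ (f i, g j))) \<noteq> 0"
proof -
  obtain g where g: "inj_on g {..<k}" "g ` {..<k} \<subseteq> {..<n}"
    and rX: "vec_space.rank m (mat m k (\<lambda>(i, j). N $$ (i, g j))) = k"
    using vec_space.rank_factor[OF N] unfolding k_def by metis
  define X where "X = transpose_mat (mat m k (\<lambda>(i, j). N $$ (i, g j)))"
  have X: "X \<in> carrier_mat k m" by (simp add: X_def)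
  have rX: "vec_space.rank k X = k" unfolding X_def
    by (subst rank_transpose) (use rX in auto)
  obtain f where f: "inj_on f {..<k}" "f ` {..<k} \<subseteq> {..<m}"
    and r: "vec_space.rank k (mat k k (\<lambda>(i, j). X $$ (i, f j))) = k"
    using vec_space.rank_factor[OF X] unfolding rX by metis
  let ?Z = "mat k k (\<lambda>(i, j). X $$ (i, f j))"
  have "det ?Z \<noteq> 0" using vec_space.det_rank_iff[of ?Z k] r by simp
  moreover have "transpose_mat ?Z = mat k k (\<lambda>(i, j). N $$ (f i, g j))"
    by (rule eq_matI) (use f in \<open>auto simp: X_def\<close>)
  ultimately have "det (mat k k (\<lambda>(i, j). N $$ (f i, g j))) \<noteq> 0"
    using det_transpose[of ?Z k] by simp
  then show ?thesis using that f g by blast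
qed

lemma delta_minor_imp_le_rank:
  fixes N :: "'a::field mat"
  assumes N: "N \<in> carrier_mat m n" and f: "f ` {..<k} \<subseteq> {..<m}" and g: "g ` {..<k} \<subseteq> {..<n}"
    and "\<And>i j. i < k \<Longrightarrow> j < k \<Longrightarrow> N $$ (f i, g j) = (if i = j then 1 else 0)"
  shows "k \<le> vec_space.rank m N"
proof (rule minor_imp_le_rank[OF N f g])
  have "mat k k (\<lambda>(i, j). N $$ (f i, g j)) = 1\<^sub>m k"
    by (rule eq_matI) (use assms in auto)
  then show "det (mat k k (\<lambda>(i, j). N $$ (f i, g j))) \<noteq> 0" by simp
qed

lemma rank_le_nonzero_rows:
  fixes N :: "'a::field mat"
  assumes N: "N \<in> carrier_mat m n" and z: "\<And>i j. k \<le> i \<Longrightarrow> i < m \<Longrightarrow> j < n \<Longrightarrow> N $$ (i, j) = 0"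
  shows "vec_space.rank m N \<le> k"
proof -
  define X :: "'a mat" where "X = mat m k (\<lambda>(i, j). if i = j then 1 else 0)"
  \<comment> \<open>\<open>X\<close> consists of the first \<open>k\<close> columns of an identity.
    Since \<open>k\<close> may exceed \<open>m\<close>, the guard fills the surplus rows of
    \<open>Y\<close> with zeros.\<close>
  define Y where "Y = mat k n (\<lambda>(i, j). if i < m then N $$ (i, j) else 0)"
  have "N = X * Y"
  proof (rule eq_matI)
    fix i j assume "i < dim_row (X * Y)" "j < dim_col (X * Y)"
    then have ij: "i < m" "j < n" by (auto simp: X_def Y_def)
    have "(X * Y) $$ (i, j) = (\<Sum>a\<in>{0..<k}. (if i = a then 1 else 0) * (if a < m then N $$ (a, j) else 0))"
      using ij by (simp add: X_def Y_def scalar_prod_def)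
    also have "\<dots> = (\<Sum>a\<in>{0..<k}. if i = a then N $$ (i, j) else 0)"
      by (rule sum.cong) (use ij in auto)
    also have "\<dots> = N $$ (i, j)" using z[of i j] ij by (auto simp: not_less)
    finally show "N $$ (i, j) = (X * Y) $$ (i, j)" by simp
  qed (use N in \<open>auto simp: X_def Y_def\<close>)
  then show ?thesis using rank_mult_le_inner[of X m k Y n] by (simp add: X_def Y_def)
qed

lemma rank_le_nonzero_cols:
  fixes N :: "'a::field mat"
  assumes N: "N \<in> carrier_mat m n" and z: "\<And>i j. i < m \<Longrightarrow> k \<le> j \<Longrightarrow> j < n \<Longrightarrow> N $$ (i, j) = 0"
  shows "vec_space.rank m N \<le> k"
proof -
  have "vec_space.rank n (transpose_mat N) \<le> k"
    by (rule rank_le_nonzero_rows[where n = m]) (use N z in auto)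
  then show ?thesis by (simp add: rank_transpose[OF N])
qed

section \<open>Canonical form of a pair of matrices\<close>

lemma det_nonzero_obtain_inverse:
  fixes S :: "'a::field mat"
  assumes S: "S \<in> carrier_mat n n" and "det S \<noteq> 0"
  obtains T where "T \<in> carrier_mat n n" "S * T = 1\<^sub>m n" "T * S = 1\<^sub>m n" "det T \<noteq> 0"
proof -
  obtain T where T: "T \<in> carrier_mat n n" "S * T = 1\<^sub>m n" "T * S = 1\<^sub>m n"
    using det_non_zero_imp_unit[OF assms] unfolding Units_def ring_mat_def by auto
  have "det S * det T = 1" using det_mult[OF S T(1)] T(2) by simp
  then have "det T \<noteq> 0" by auto
  then show ?thesis using that T by blast
qed

lemma invertible_mat_iff_det_nonzero:
  fixes S :: "'a::field mat"
  assumes S: "S \<in> carrier_mat n n"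
  shows "invertible_mat S \<longleftrightarrow> det S \<noteq> 0"
proof
  assume "invertible_mat S"
  then obtain T where T: "S * T = 1\<^sub>m n" "T * S = 1\<^sub>m (dim_row T)"
    using S unfolding invertible_mat_def inverts_mat_def by auto
  \<comment> \<open>\<open>invertible_mat\<close> does not fix the size of the inverse; it is read
    off from the two products.\<close>
  have "dim_col (S * T) = n" "dim_col (T * S) = dim_row T" using T by simp_all
  then have "T \<in> carrier_mat n n" using S by auto
  then have "det S * det T = 1" using det_mult[OF S] T(1) by (metis det_one)
  then show "det S \<noteq> 0" by auto
next
  assume "det S \<noteq> 0"
  then show "invertible_mat S"
    using S by (elim det_nonzero_obtain_inverse[OF S]) (auto simp: invertible_mat_def inverts_mat_def)
qed

section \<open>Equivalence of pairs\<close>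

lemma bip_reduces_iff:
  fixes A B :: "'a::field mat"
  assumes "A \<in> carrier_mat m p" "B \<in> carrier_mat m q"
  shows "bip_reduces (A, B) N \<longleftrightarrow> (\<exists>S R1 R2. S \<in> carrier_mat m m \<and> det S \<noteq> 0 \<and>
    R1 \<in> carrier_mat p p \<and> det R1 \<noteq> 0 \<and> R2 \<in> carrier_mat q q \<and> det R2 \<noteq> 0 \<and>
    N = (S * A * R1, S * B * R2))"
proof -
  have dims: "dim_row A = m" "dim_col A = p" "dim_col B = q" using assms by auto
  show ?thesis
    unfolding bip_reduces_def fst_conv snd_conv dims
    by (simp only: invertible_mat_iff_det_nonzero cong: conj_cong)
qed

lemma bip_reducesI:
  fixes A B :: "'a::field mat"
  assumes "A \<in> carrier_mat m p" "B \<in> carrier_mat m q"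
    "S \<in> carrier_mat m m" "det S \<noteq> 0" "R1 \<in> carrier_mat p p" "det R1 \<noteq> 0"
    "R2 \<in> carrier_mat q q" "det R2 \<noteq> 0" "S * A * R1 = A'" "S * B * R2 = B'"
  shows "bip_reduces (A, B) (A', B')"
  unfolding bip_reduces_iff[OF assms(1,2)] using assms(3-) by blast

lemma assoc_mult_mat5:
  assumes T: "T \<in> carrier_mat m m" and S: "S \<in> carrier_mat m m" and X: "X \<in> carrier_mat m n"
    and R: "R \<in> carrier_mat n n" and Q: "Q \<in> carrier_mat n n"
  shows "T * (S * X * R) * Q = (T * S) * X * (R * Q)"
proof -
  have SX: "S * X \<in> carrier_mat m n" and TS: "T * S \<in> carrier_mat m m" using assms by auto
  have "T * (S * X * R) * Q = T * (S * X) * R * Q"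
    unfolding assoc_mult_mat[OF T SX R] ..
  also have "\<dots> = T * S * X * R * Q"
    unfolding assoc_mult_mat[OF T S X] ..
  also have "\<dots> = T * S * X * (R * Q)"
    by (rule assoc_mult_mat[OF mult_carrier_mat[OF TS X] R Q])
  finally show ?thesis .
qed

lemma bip_reduces_trans:
  fixes A B :: "'a::field mat"
  assumes A: "A \<in> carrier_mat m p" and B: "B \<in> carrier_mat m q"
    and 1: "bip_reduces (A, B) N" and 2: "bip_reduces N N'"
  shows "bip_reduces (A, B) N'"
proof -
  obtain S R1 R2 where S: "S \<in> carrier_mat m m" "det S \<noteq> 0" and R1: "R1 \<in> carrier_mat p p" "det R1 \<noteq> 0"
    and R2: "R2 \<in> carrier_mat q q" "det R2 \<noteq> 0" and N: "N = (S * A * R1, S * B * R2)"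
    using 1 unfolding bip_reduces_iff[OF A B] by blast
  have "S * A * R1 \<in> carrier_mat m p" "S * B * R2 \<in> carrier_mat m q" using S R1 R2 A B by auto
  then obtain T Q1 Q2 where T: "T \<in> carrier_mat m m" "det T \<noteq> 0" and Q1: "Q1 \<in> carrier_mat p p" "det Q1 \<noteq> 0"
    and Q2: "Q2 \<in> carrier_mat q q" "det Q2 \<noteq> 0"
    and N': "N' = (T * (S * A * R1) * Q1, T * (S * B * R2) * Q2)"
    using 2 bip_reduces_iff[of "S * A * R1" m p "S * B * R2" q N'] unfolding N by auto
  have "N' = (T * S * A * (R1 * Q1), T * S * B * (R2 * Q2))"
    unfolding N' assoc_mult_mat5[OF T(1) S(1) A R1(1) Q1(1)]
      assoc_mult_mat5[OF T(1) S(1) B R2(1) Q2(1)] by (rule refl)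
  moreover have "det (T * S) \<noteq> 0" "det (R1 * Q1) \<noteq> 0" "det (R2 * Q2) \<noteq> 0"
    using S T R1 R2 Q1 Q2 by (simp_all add: det_mult[of _ m] det_mult[of _ p] det_mult[of _ q])
  ultimately show ?thesis
    unfolding bip_reduces_iff[OF A B]
    by (intro exI[of _ "T * S"] exI[of _ "R1 * Q1"] exI[of _ "R2 * Q2"] conjI mult_carrier_mat[OF T(1) S(1)]
        mult_carrier_mat[OF R1(1) Q1(1)] mult_carrier_mat[OF R2(1) Q2(1)])
qed

lemma bip_reduces_sym:
  fixes A B :: "'a::field mat"
  assumes A: "A \<in> carrier_mat m p" and B: "B \<in> carrier_mat m q"
    and 1: "bip_reduces (A, B) N"
  shows "bip_reduces N (A, B)"
proof -
  obtain S R1 R2 where S: "S \<in> carrier_mat m m" "det S \<noteq> 0" and R1: "R1 \<in> carrier_mat p p" "det R1 \<noteq> 0"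
    and R2: "R2 \<in> carrier_mat q q" "det R2 \<noteq> 0" and N: "N = (S * A * R1, S * B * R2)"
    using 1 unfolding bip_reduces_iff[OF A B] by blast
  obtain T where T: "T \<in> carrier_mat m m" "T * S = 1\<^sub>m m" "det T \<noteq> 0"
    by (rule det_nonzero_obtain_inverse[OF S])
  obtain Q1 where Q1: "Q1 \<in> carrier_mat p p" "R1 * Q1 = 1\<^sub>m p" "det Q1 \<noteq> 0"
    by (rule det_nonzero_obtain_inverse[OF R1])
  obtain Q2 where Q2: "Q2 \<in> carrier_mat q q" "R2 * Q2 = 1\<^sub>m q" "det Q2 \<noteq> 0"
    by (rule det_nonzero_obtain_inverse[OF R2])
  have cancel: "T * (S * X * R) * Q = X"
    if X: "X \<in> carrier_mat m n" and R: "R \<in> carrier_mat n n" "Q \<in> carrier_mat n n" "R * Q = 1\<^sub>m n" for X R Q n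
  proof -
    have "T * (S * X * R) = T * (S * (X * R))"
      by (subst assoc_mult_mat[OF S(1) X R(1)]) simp
    also have "\<dots> = T * S * (X * R)"
      by (rule assoc_mult_mat[symmetric, OF T(1) S(1)]) (use X R in auto)
    also have "\<dots> = X * R" unfolding T(2) using X R by simp
    also have "X * R * Q = X" using assoc_mult_mat[OF X R(1,2)] R(3) X by simp
    finally show ?thesis .
  qed
  show ?thesis unfolding N
    by (rule bip_reducesI[where S = T and ?R1.0 = Q1 and ?R2.0 = Q2 and m = m and p = p and q = q])
       (use S R1 R2 A B T Q1 Q2 cancel in auto)
qed

lemma canonical_left_carrier [simp]: "canonical_left m p r s \<in> carrier_mat m p"
  by (simp add: canonical_left_def)

lemma canonical_right_carrier [simp]: "canonical_right m q r s t \<in> carrier_mat m q"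
  by (simp add: canonical_right_def)

lemma canonical_left_block:
  assumes "k \<le> m" "k \<le> p"
  shows "canonical_left m p 0 k =
    four_block_mat (1\<^sub>m k) (0\<^sub>m k (p - k)) (0\<^sub>m (m - k) k) (0\<^sub>m (m - k) (p - k))"
  by (rule eq_matI) (use assms in \<open>auto simp: canonical_left_def\<close>)

lemma det_block_diag:
  fixes S T :: "'a::field mat"
  assumes "S \<in> carrier_mat k k" "T \<in> carrier_mat l l"
  shows "det (four_block_mat S (0\<^sub>m k l) (0\<^sub>m l k) T) = det S * det T"
  by (rule det_four_block_mat_lower_left_zero) (use assms in auto)

section \<open>Elimination\<close>

lemma exists_pivot_reduction:
  fixes N :: "'a::field mat"
  assumes N: "N \<in> carrier_mat (Suc m) (Suc n)" and N0: "N \<noteq> 0\<^sub>m (Suc m) (Suc n)"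
  obtains S R W where "S \<in> carrier_mat (Suc m) (Suc m)" "det S \<noteq> 0"
    "R \<in> carrier_mat (Suc n) (Suc n)" "det R \<noteq> 0" "W \<in> carrier_mat m n"
    "S * N * R = four_block_mat (1\<^sub>m 1) (0\<^sub>m 1 n) (0\<^sub>m m 1) W"
proof -
  let ?m = "Suc m" and ?n = "Suc n"
  obtain i j where ij: "i < ?m" "j < ?n" "N $$ (i, j) \<noteq> 0"
    using N N0 by (metis carrier_matD eq_matI index_zero_mat(1) index_zero_mat(2) index_zero_mat(3))
  define P :: "'a mat" where "P = swaprows_mat ?m 0 i"
  define Q :: "'a mat" where "Q = swaprows_mat ?n 0 j"
  have P: "P \<in> carrier_mat ?m ?m" and Q: "Q \<in> carrier_mat ?n ?n" by (simp_all add: P_def Q_def)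
  \<comment> \<open>The pivot may already sit in the first row or column; the swap is then the
    identity, with determinant 1 instead of -1.\<close>
  have "det (swaprows_mat n' 0 i') \<noteq> (0::'a)" if "i' < n'" for i' n'
  proof (cases "i' = 0")
    case True
    have "swaprows_mat n' 0 0 = (1\<^sub>m n' :: 'a mat)"
      by (rule eq_matI) auto
    then show ?thesis using True by simp
  next
    case False
    then show ?thesis using that det_swaprows_mat[of 0 n' i', where 'a = 'a] by simp
  qed
  then have dP: "det P \<noteq> 0" and dQ: "det Q \<noteq> 0" using ij by (auto simp: P_def Q_def)
  define N1 where "N1 = P * N * Q"
  have "N1 = swapcols 0 j (swaprows 0 i N)"
    unfolding N1_def P_def Q_def
    by (subst swaprows_mat[OF N, symmetric], use ij in simp, use ij in simp, rule swapcols_mat[symmetric])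
       (use N ij in auto)
  then have a: "N1 $$ (0, 0) \<noteq> 0" using N ij by auto
  have N1: "N1 \<in> carrier_mat ?m ?n" using P Q N by (simp add: N1_def)
  define a where "a = N1 $$ (0, 0)"
  obtain A1 A2 A3 A4 where split: "split_block N1 1 1 = (A1, A2, A3, A4)" by (metis prod_cases4)
  have A: "A1 \<in> carrier_mat 1 1" "A2 \<in> carrier_mat 1 n" "A3 \<in> carrier_mat m 1" "A4 \<in> carrier_mat m n"
    "N1 = four_block_mat A1 A2 A3 A4"
    using split_block[OF split, of m n] N1 by auto
  have A1: "A1 $$ (0, 0) = a" using A N1 by (simp add: a_def)
  define B1 where "B1 = mat 1 1 (\<lambda>_. inverse a)"
  have B1: "B1 \<in> carrier_mat 1 1" by (simp add: B1_def)
  have BA: "B1 * A1 = 1\<^sub>m 1"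
    by (rule eq_matI) (use A A1 a in \<open>auto simp: B1_def scalar_prod_def a_def\<close>)
  have dB1: "det B1 \<noteq> 0" using a by (subst det_single) (auto simp: B1_def a_def)
  \<comment> \<open>\<open>S1\<close> scales the pivot to 1 and clears the column below it,
    \<open>R1\<close> clears the rest of the pivot row, and \<open>W\<close> is the Schur complement
    of the pivot.\<close>
  define S1 where "S1 = four_block_mat B1 (0\<^sub>m 1 m) (- (A3 * B1)) (1\<^sub>m m)"
  define R1 where "R1 = four_block_mat (1\<^sub>m 1) (- (B1 * A2)) (0\<^sub>m n 1) (1\<^sub>m n)"
  define W where "W = - (A3 * B1) * A2 + A4"
  have S1: "S1 \<in> carrier_mat ?m ?m" "det S1 \<noteq> 0"
    unfolding S1_def using A B1 dB1 by (auto simp: det_four_block_mat_upper_right_zero[of B1 1 _ m])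
  have BA2: "- (B1 * A2) \<in> carrier_mat 1 n" using A B1 by simp
  have R1: "R1 \<in> carrier_mat ?n ?n" "det R1 \<noteq> 0"
    unfolding R1_def det_four_block_mat_lower_left_zero[OF one_carrier_mat BA2 refl one_carrier_mat] by auto
  have W: "W \<in> carrier_mat m n" using A B1 by (simp add: W_def)
  have A3: "- (A3 * B1) * A1 + A3 = 0\<^sub>m m 1"
  proof -
    have "A3 * B1 * A1 = A3" using assoc_mult_mat[OF A(3) B1 A(1)] BA A by simp
    then have "- (A3 * B1) * A1 = - A3" using A B1 by simp
    then show ?thesis using A by simp
  qed
  have "S1 * N1 = four_block_mat (1\<^sub>m 1) (B1 * A2) (0\<^sub>m m 1) W"
    unfolding S1_def A(5)
    by (subst mult_four_block_mat[where ?nr1.0 = 1 and ?n1.0 = 1 and ?n2.0 = m and ?nr2.0 = m and ?nc1.0 = 1 and ?nc2.0 = n])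
       (use A B1 BA A3 in \<open>auto simp: W_def\<close>)
  then have "S1 * N1 * R1 = four_block_mat (1\<^sub>m 1) (0\<^sub>m 1 n) (0\<^sub>m m 1) W"
    unfolding R1_def using BA2 A B1 W
    by (simp only:, subst mult_four_block_mat[where ?nr1.0 = 1 and ?n1.0 = 1 and ?n2.0 = n and ?nr2.0 = m and ?nc1.0 = 1 and ?nc2.0 = n])
       (auto simp: uminus_l_inv_mat[of _ 1 n])
  also have "S1 * N1 * R1 = (S1 * P) * N * (Q * R1)"
    unfolding N1_def by (rule assoc_mult_mat5[OF S1(1) P N Q R1(1)])
  finally show ?thesis
    using that[of "S1 * P" "Q * R1" W] S1 R1 P Q dP dQ W det_mult[OF S1(1) P] det_mult[OF Q R1(1)]
    by (simp del: assoc_mult_mat)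
qed

text \<open>\<open>canonical_left m n 0 k\<close> is \<open>diag(I_k, 0)\<close>. Each pivot leaves
  a block with one row and one column less; the transformations of that block are extended by a 1 in
  the pivot position.\<close>

lemma exists_rank_normal_form:
  fixes N :: "'a::field mat"
  assumes "N \<in> carrier_mat m n"
  shows "\<exists>k S R. k \<le> m \<and> k \<le> n \<and> S \<in> carrier_mat m m \<and> det S \<noteq> 0 \<and>
    R \<in> carrier_mat n n \<and> det R \<noteq> 0 \<and> S * N * R = canonical_left m n 0 k"
  using assms
proof (induction m arbitrary: n N)
  case 0
  then show ?case
    by (intro exI[of _ 0] exI[of _ "1\<^sub>m 0"] exI[of _ "1\<^sub>m n"])
       (auto simp: canonical_left_def)
next
  case (Suc m)
  show ?case
  proof (cases "N = 0\<^sub>m (Suc m) n")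
    case True
    then show ?thesis
      by (intro exI[of _ 0] exI[of _ "1\<^sub>m (Suc m)"] exI[of _ "1\<^sub>m n"])
         (auto simp: canonical_left_def)
  next
    case False
    then obtain n' where n: "n = Suc n'"
      using Suc.prems by (cases n) auto
    obtain S R W where S: "S \<in> carrier_mat (Suc m) (Suc m)" "det S \<noteq> 0"
      and R: "R \<in> carrier_mat n n" "det R \<noteq> 0" and W: "W \<in> carrier_mat m n'"
      and SNR: "S * N * R = four_block_mat (1\<^sub>m 1) (0\<^sub>m 1 n') (0\<^sub>m m 1) W"
      using exists_pivot_reduction[of N m n'] Suc.prems False unfolding n by metis
    obtain k S' R' where k: "k \<le> m" "k \<le> n'" and S': "S' \<in> carrier_mat m m" "det S' \<noteq> 0"
      and R': "R' \<in> carrier_mat n' n'" "det R' \<noteq> 0" and SWR: "S' * W * R' = canonical_left m n' 0 k"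
      using Suc.IH[OF W] by blast
    define T where "T = four_block_mat (1\<^sub>m 1) (0\<^sub>m 1 m) (0\<^sub>m m 1) S'"
    define Q where "Q = four_block_mat (1\<^sub>m 1) (0\<^sub>m 1 n') (0\<^sub>m n' 1) R'"
    have T: "T \<in> carrier_mat (Suc m) (Suc m)" "det T \<noteq> 0"
      unfolding T_def det_block_diag[OF one_carrier_mat S'(1)] using S' by auto
    have Q: "Q \<in> carrier_mat n n" "det Q \<noteq> 0"
      unfolding Q_def n det_block_diag[OF one_carrier_mat R'(1)] using R' by auto
    have "T * (S * N * R) = four_block_mat (1\<^sub>m 1) (0\<^sub>m 1 n') (0\<^sub>m m 1) (S' * W)"
      unfolding SNR T_def using S' W
      by (subst mult_four_block_mat[where ?nr1.0 = 1 and ?n1.0 = 1 and ?n2.0 = m and ?nr2.0 = m and ?nc1.0 = 1 and ?nc2.0 = n']) auto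
    then have "T * (S * N * R) * Q = four_block_mat (1\<^sub>m 1) (0\<^sub>m 1 n') (0\<^sub>m m 1) (S' * W * R')"
      unfolding Q_def using S' W R'
      by (simp del: assoc_mult_mat, subst mult_four_block_mat[where ?nr1.0 = 1 and ?n1.0 = 1 and ?n2.0 = n' and ?nr2.0 = m and ?nc1.0 = 1 and ?nc2.0 = n'])
         (auto simp del: assoc_mult_mat)
    also have "\<dots> = canonical_left (Suc m) n 0 (Suc k)"
      unfolding SWR n by (rule eq_matI) (auto simp: canonical_left_def)
    also have "T * (S * N * R) * Q = (T * S) * N * (R * Q)"
      by (rule assoc_mult_mat5[OF T(1) S(1) Suc.prems R(1) Q(1)])
    finally show ?thesis
      using k n S R T Q det_mult[OF T(1) S(1)] det_mult[OF R(1) Q(1)]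
      by (intro exI[of _ "Suc k"] exI[of _ "T * S"] exI[of _ "R * Q"]) (simp del: assoc_mult_mat)
  qed
qed

text \<open>Once the left block is \<open>diag(I_k, 0)\<close>, these are the rows in which it
  vanishes, so that row operations among them change the right block only.\<close>

definition lower_rows :: "nat \<Rightarrow> 'a mat \<Rightarrow> 'a mat" where
  "lower_rows k M = mat (dim_row M - k) (dim_col M) (\<lambda>(i, j). M $$ (k + i, j))"

lemma lower_rows_mult:
  assumes "k \<le> m" "M \<in> carrier_mat m n" "R \<in> carrier_mat n l"
  shows "lower_rows k (M * R) = lower_rows k M * R"
proof (rule eq_matI)
  fix i j assume "i < dim_row (lower_rows k M * R)" "j < dim_col (lower_rows k M * R)"
  then have ij: "i < m - k" "j < l" using assms by (auto simp: lower_rows_def)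
  have "row M (k + i) = row (lower_rows k M) i"
    by (rule eq_vecI) (use assms ij in \<open>auto simp: lower_rows_def\<close>)
  then show "lower_rows k (M * R) $$ (i, j) = (lower_rows k M * R) $$ (i, j)"
    using assms ij by (simp add: lower_rows_def)
qed (use assms in \<open>auto simp: lower_rows_def\<close>)

lemma lower_rows_block_diag_mult:
  fixes M :: "'a::field mat"
  assumes k: "k \<le> m" and M: "M \<in> carrier_mat m n" and S: "S \<in> carrier_mat (m - k) (m - k)"
  shows "lower_rows k (four_block_mat (1\<^sub>m k) (0\<^sub>m k (m - k)) (0\<^sub>m (m - k) k) S * M) = S * lower_rows k M"
proof -
  define U where "U = mat k n (\<lambda>(i, j). M $$ (i, j))"
  define V where "V = lower_rows k M"
  have UV: "U \<in> carrier_mat k n" "V \<in> carrier_mat (m - k) n"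
    using M by (auto simp: U_def V_def lower_rows_def)
  \<comment> \<open>Blocks without columns turn a horizontal cut into a four-block matrix.\<close>
  have "M = four_block_mat U (0\<^sub>m k 0) V (0\<^sub>m (m - k) 0)"
    by (rule eq_matI) (use k M in \<open>auto simp: U_def V_def lower_rows_def\<close>)
  then have "four_block_mat (1\<^sub>m k) (0\<^sub>m k (m - k)) (0\<^sub>m (m - k) k) S * M
      = four_block_mat U (0\<^sub>m k 0) (S * V) (0\<^sub>m (m - k) 0)"
    using UV S by (simp only:, subst mult_four_block_mat) auto
  also have "lower_rows k \<dots> = S * V"
    by (rule eq_matI) (use UV S in \<open>auto simp: lower_rows_def\<close>)
  finally show ?thesis by (simp add: V_def)
qed

text \<open>Once the left block is \<open>J = diag(I_k, 0)\<close>, block upper triangular row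
  operations are harmless: their effect on \<open>J\<close> can be undone by column operations on
  the left block. Accordingly the lower rows of the right block are normalized first, giving
  \<open>I_t\<close>; these clear the entries above them; and what remains in the upper rows, the
  block \<open>D\<close>, gives the shared \<open>I_r\<close>.\<close>

lemma exists_canonical_form:
  fixes A B :: "'a::field mat"
  assumes A: "A \<in> carrier_mat m p" and B: "B \<in> carrier_mat m q"
  shows "\<exists>r s t. r + s + t \<le> m \<and> r + s \<le> p \<and> r + t \<le> q \<and>
    bip_reduces (A, B) (canonical_left m p r s, canonical_right m q r s t)"
proof -
  obtain k S1 R1 where k: "k \<le> m" "k \<le> p" and S1: "S1 \<in> carrier_mat m m" "det S1 \<noteq> 0"
    and R1: "R1 \<in> carrier_mat p p" "det R1 \<noteq> 0" and J: "S1 * A * R1 = canonical_left m p 0 k"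
    using exists_rank_normal_form[OF A] by blast
  define J where "J = (canonical_left m p 0 k :: 'a mat)"
  have Jc: "J \<in> carrier_mat m p" by (simp add: J_def)
  define B1 where "B1 = S1 * B * 1\<^sub>m q"
  have B1: "B1 \<in> carrier_mat m q" using S1 B by (simp add: B1_def)
  have 1: "bip_reduces (A, B) (J, B1)"
    by (rule bip_reducesI[OF A B S1 R1 one_carrier_mat _ _ _]) (simp_all only: J J_def B1_def det_one, simp)
  define m' where "m' = m - k"
  have J_block: "J = four_block_mat (1\<^sub>m k) (0\<^sub>m k (p - k)) (0\<^sub>m m' k) (0\<^sub>m m' (p - k))"
    unfolding J_def m'_def by (rule canonical_left_block[OF k])
  have m: "k + m' = m" and p: "k + (p - k) = p" using k by (auto simp: m'_def)
  \<comment> \<open>Since \<open>J\<close> vanishes below row \<open>k\<close>, such a row operation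
    acts on it only through \<open>X\<close>.\<close>
  have blockJ: "four_block_mat X Y (0\<^sub>m m' k) Z * J =
      four_block_mat X (0\<^sub>m k (p - k)) (0\<^sub>m m' k) (0\<^sub>m m' (p - k))"
    if "X \<in> carrier_mat k k" "Y \<in> carrier_mat k m'" "Z \<in> carrier_mat m' m'" for X Y Z
    unfolding J_block using that by (subst mult_four_block_mat) auto
  have block_carrier: "four_block_mat X Y Z W \<in> carrier_mat m m"
    if "X \<in> carrier_mat k k" "W \<in> carrier_mat m' m'" for X Y Z W :: "'a mat"
    using that four_block_carrier_mat[of X k k W m' m'] m by simp

  have V: "lower_rows k B1 \<in> carrier_mat m' q" using B1 by (simp add: lower_rows_def m'_def)
  obtain t S2 R2 where t: "t \<le> m'" "t \<le> q" and S2: "S2 \<in> carrier_mat m' m'" "det S2 \<noteq> 0"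
    and R2: "R2 \<in> carrier_mat q q" "det R2 \<noteq> 0" and V2: "S2 * lower_rows k B1 * R2 = canonical_left m' q 0 t"
    using exists_rank_normal_form[OF V] by blast
  define T2 where "T2 = four_block_mat (1\<^sub>m k) (0\<^sub>m k m') (0\<^sub>m m' k) S2"
  have T2: "T2 \<in> carrier_mat m m" "det T2 \<noteq> 0"
    unfolding T2_def det_block_diag[OF one_carrier_mat S2(1)] using S2 block_carrier by auto
  define B2 where "B2 = T2 * B1 * R2"
  have B2: "B2 \<in> carrier_mat m q" using T2 B1 R2 by (simp add: B2_def)
  have TJ: "T2 * J * 1\<^sub>m p = J"
    unfolding T2_def blockJ[OF one_carrier_mat zero_carrier_mat S2(1)] J_block[symmetric] using Jc by simp
  have 2: "bip_reduces (J, B1) (J, B2)"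
    by (rule bip_reducesI[OF Jc B1 T2 one_carrier_mat _ R2 TJ]) (simp_all only: B2_def det_one, simp)
  have "lower_rows k B2 = lower_rows k (T2 * B1) * R2"
    unfolding B2_def by (rule lower_rows_mult[OF k(1) mult_carrier_mat[OF T2(1) B1] R2(1)])
  also have "lower_rows k (T2 * B1) = S2 * lower_rows k B1"
    unfolding T2_def m'_def by (rule lower_rows_block_diag_mult[OF k(1) B1]) (use S2 in \<open>simp add: m'_def\<close>)
  also note V2
  finally have low: "lower_rows k B2 = canonical_left m' q 0 t" .

  \<comment> \<open>The columns are cut after \<open>t\<close>: below row \<open>k\<close> the first
    \<open>t\<close> columns hold \<open>E\<close>, which is \<open>I_t\<close> on top of zero rows,
    and the other columns vanish.\<close>
  define C where "C = mat k t (\<lambda>(i, j). B2 $$ (i, j))"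
  define D where "D = mat k (q - t) (\<lambda>(i, j). B2 $$ (i, t + j))"
  define E where "E = (mat m' t (\<lambda>(i, j). if i = j then 1 else 0) :: 'a mat)"
  have CDE: "C \<in> carrier_mat k t" "D \<in> carrier_mat k (q - t)" "E \<in> carrier_mat m' t"
    by (simp_all add: C_def D_def E_def)
  have low_entry: "B2 $$ (i, j) = (if i - k = j \<and> j < t then 1 else 0)" if "k \<le> i" "i < m" "j < q" for i j
  proof -
    have "B2 $$ (i, j) = lower_rows k B2 $$ (i - k, j)"
      using that B2 by (simp add: lower_rows_def)
    then show ?thesis unfolding low using that by (auto simp: canonical_left_def m'_def)
  qed
  have B2_block: "B2 = four_block_mat C D E (0\<^sub>m m' (q - t))"
    by (rule eq_matI) (use B2 k t m low_entry in \<open>auto simp: C_def D_def E_def\<close>)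
  \<comment> \<open>Because \<open>t \<le> m'\<close>, the transpose is a left inverse of
    \<open>E\<close>; this is what makes \<open>X * E = - C\<close> solvable by the \<open>X\<close>
    below.\<close>
  have EE: "transpose_mat E * E = 1\<^sub>m t"
  proof (rule eq_matI)
    fix i j assume "i < dim_row (1\<^sub>m t)" "j < dim_col (1\<^sub>m t)"
    then have ij: "i < t" "j < t" by auto
    have "(transpose_mat E * E) $$ (i, j) = (\<Sum>a\<in>{0..<m'}. (if a = i then 1 else 0) * (if a = j then 1 else 0))"
      using ij by (simp add: E_def scalar_prod_def)
    also have "\<dots> = (\<Sum>a\<in>{0..<m'}. if a = i then (if i = j then 1 else 0) else 0)"
      by (rule sum.cong) auto
    also have "\<dots> = 1\<^sub>m t $$ (i, j)" using ij t by simp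
    finally show "(transpose_mat E * E) $$ (i, j) = 1\<^sub>m t $$ (i, j)" .
  qed (simp_all add: E_def)
  \<comment> \<open>The block \<open>C\<close> is cleared by adding multiples of the rows of \<open>[E|0]\<close>; this leaves \<open>J\<close> alone
    because \<open>J\<close> vanishes in these rows.\<close>
  define X where "X = - (C * transpose_mat E)"
  have X: "X \<in> carrier_mat k m'" using CDE by (simp add: X_def)
  define T3 where "T3 = four_block_mat (1\<^sub>m k) X (0\<^sub>m m' k) (1\<^sub>m m')"
  have T3: "T3 \<in> carrier_mat m m" "det T3 \<noteq> 0"
    unfolding T3_def det_four_block_mat_lower_left_zero[OF one_carrier_mat X refl one_carrier_mat]
    using block_carrier by auto
  have "X * E = - C"
  proof -
    have "C * transpose_mat E * E = C"
      using assoc_mult_mat[OF CDE(1), of "transpose_mat E" m' E t] CDE EE by simp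
    then show ?thesis using CDE by (simp add: X_def)
  qed
  then have XE: "C + X * E = 0\<^sub>m k t"
    by (simp only:, intro eq_matI) (use CDE in auto)
  define B3 where "B3 = four_block_mat (0\<^sub>m k t) D E (0\<^sub>m m' (q - t))"
  have B3: "B3 \<in> carrier_mat m q"
    using four_block_carrier_mat[of "0\<^sub>m k t" k t "0\<^sub>m m' (q - t)" m' "q - t"] m t by (simp add: B3_def)
  have "T3 * B2 = B3"
    unfolding T3_def B2_block B3_def using CDE X XE by (subst mult_four_block_mat) auto
  then have TB: "T3 * B2 * 1\<^sub>m q = B3" using B3 by simp
  have TJ: "T3 * J * 1\<^sub>m p = J"
    unfolding T3_def blockJ[OF one_carrier_mat X one_carrier_mat] J_block[symmetric] using Jc by simp
  have 3: "bip_reduces (J, B2) (J, B3)"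
    by (rule bip_reducesI[OF Jc B2 T3 one_carrier_mat _ one_carrier_mat _ TJ TB]) simp_all

  obtain r P Q where r: "r \<le> k" "r \<le> q - t" and P: "P \<in> carrier_mat k k" "det P \<noteq> 0"
    and Q: "Q \<in> carrier_mat (q - t) (q - t)" "det Q \<noteq> 0" and PDQ: "P * D * Q = canonical_left k (q - t) 0 r"
    using exists_rank_normal_form[OF CDE(2)] by blast
  obtain P' where P': "P' \<in> carrier_mat k k" "P * P' = 1\<^sub>m k" "det P' \<noteq> 0"
    by (rule det_nonzero_obtain_inverse[OF P])
  \<comment> \<open>The row operations \<open>P\<close> spoil the identity block of \<open>J\<close>; its column operations \<open>P'\<close> restore it.\<close>
  define T4 where "T4 = four_block_mat P (0\<^sub>m k m') (0\<^sub>m m' k) (1\<^sub>m m')"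
  define U4 where "U4 = four_block_mat P' (0\<^sub>m k (p - k)) (0\<^sub>m (p - k) k) (1\<^sub>m (p - k))"
  define R4 where "R4 = four_block_mat (1\<^sub>m t) (0\<^sub>m t (q - t)) (0\<^sub>m (q - t) t) Q"
  have T4: "T4 \<in> carrier_mat m m" "det T4 \<noteq> 0"
    unfolding T4_def det_block_diag[OF P(1) one_carrier_mat] using P block_carrier by auto
  have U4: "U4 \<in> carrier_mat p p" "det U4 \<noteq> 0"
    unfolding U4_def det_block_diag[OF P'(1) one_carrier_mat]
    using P' four_block_carrier_mat[of P' k k "1\<^sub>m (p - k)" "p - k" "p - k"] p by auto
  have R4: "R4 \<in> carrier_mat q q" "det R4 \<noteq> 0"
    unfolding R4_def det_block_diag[OF one_carrier_mat Q(1)]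
    using Q t four_block_carrier_mat[of "1\<^sub>m t" t t Q "q - t" "q - t"] by auto
  have TJU: "T4 * J * U4 = J"
    unfolding T4_def blockJ[OF P(1) zero_carrier_mat one_carrier_mat] U4_def
      mult_four_block_mat[OF P(1) zero_carrier_mat zero_carrier_mat zero_carrier_mat
        P'(1) zero_carrier_mat zero_carrier_mat one_carrier_mat]
    unfolding J_block using P P' by simp
  have PD: "P * D \<in> carrier_mat k (q - t)" using P CDE by simp
  have "T4 * B3 = four_block_mat (0\<^sub>m k t) (P * D) E (0\<^sub>m m' (q - t))"
    unfolding T4_def B3_def using P CDE by (subst mult_four_block_mat) auto
  then have "T4 * B3 * R4 = four_block_mat (0\<^sub>m k t) (P * D * Q) E (0\<^sub>m m' (q - t))"
    unfolding R4_def using PD CDE Q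
    by (simp only:, subst mult_four_block_mat) (auto simp del: assoc_mult_mat)
  also have "\<dots> = canonical_right m q r (k - r) t"
    unfolding PDQ by (rule eq_matI) (use r t m in \<open>auto simp: canonical_left_def canonical_right_def E_def\<close>)
  finally have TBR: "T4 * B3 * R4 = canonical_right m q r (k - r) t" .
  \<comment> \<open>\<open>canonical_left\<close> depends on its last two arguments only through
    their sum.\<close>
  have J4: "J = canonical_left m p r (k - r)"
    using r by (simp add: J_def canonical_left_def)
  have 4: "bip_reduces (J, B3) (canonical_left m p r (k - r), canonical_right m q r (k - r) t)"
    by (rule bip_reducesI[OF Jc B3 T4 U4 R4]) (use TJU TBR J4 in auto)
  have "bip_reduces (A, B) (canonical_left m p r (k - r), canonical_right m q r (k - r) t)"
    by (rule bip_reduces_trans[OF A B 1 bip_reduces_trans[OF Jc B1 2 bip_reduces_trans[OF Jc B2 3 4]]])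
  then show ?thesis using r k t m
    by (intro exI[of _ r] exI[of _ "k - r"] exI[of _ t]) auto
qed

section \<open>The three ranks as a complete set of invariants\<close>

lemma bip_mat_carrier:
  assumes "A \<in> carrier_mat m p" "B \<in> carrier_mat m q"
  shows "bip_mat A B \<in> carrier_mat m (p + q)"
  using assms four_block_carrier_mat[of A m p "0\<^sub>m 0 q" 0 q] by (simp add: bip_mat_def)

lemma index_bip_mat:
  assumes "A \<in> carrier_mat m p" "B \<in> carrier_mat m q" "i < m" "j < p + q"
  shows "bip_mat A B $$ (i, j) = (if j < p then A $$ (i, j) else B $$ (i, j - p))"
  using assms by (simp add: bip_mat_def)

lemma map_mat_bip_mat:
  assumes "A \<in> carrier_mat m p" "B \<in> carrier_mat m q"
  shows "map_mat h (bip_mat A B) = bip_mat (map_mat h A) (map_mat h B)"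
proof (rule eq_matI)
  fix i j assume "i < dim_row (bip_mat (map_mat h A) (map_mat h B))"
    "j < dim_col (bip_mat (map_mat h A) (map_mat h B))"
  then have "i < m" "j < p + q"
    using bip_mat_carrier[of "map_mat h A" m p "map_mat h B" q] assms by auto
  then show "map_mat h (bip_mat A B) $$ (i, j) = bip_mat (map_mat h A) (map_mat h B) $$ (i, j)"
    using assms bip_mat_carrier[OF assms]
    by (simp add: index_bip_mat[of _ m p _ q])
qed (use assms bip_mat_carrier[OF assms] bip_mat_carrier[of "map_mat h A" m p "map_mat h B" q] in auto)

text \<open>A reduction of the pair is an equivalence of \<open>[A|B]\<close> with block diagonal
  column operations; this makes the rank of \<open>[A|B]\<close> an invariant of the pair.\<close>

lemma bip_mat_mult:
  fixes A B :: "'a::field mat"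
  assumes A: "A \<in> carrier_mat m p" and B: "B \<in> carrier_mat m q" and S: "S \<in> carrier_mat m m"
    and R1: "R1 \<in> carrier_mat p p" and R2: "R2 \<in> carrier_mat q q"
  shows "bip_mat (S * A * R1) (S * B * R2) =
    S * bip_mat A B * four_block_mat R1 (0\<^sub>m p q) (0\<^sub>m q p) R2"
proof -
  have "S = four_block_mat S (0\<^sub>m m 0) (0\<^sub>m 0 m) (0\<^sub>m 0 0)"
    by (rule eq_matI) (use S in auto)
  then have "S * bip_mat A B = four_block_mat S (0\<^sub>m m 0) (0\<^sub>m 0 m) (0\<^sub>m 0 0) * four_block_mat A B (0\<^sub>m 0 p) (0\<^sub>m 0 q)"
    using A B by (simp add: bip_mat_def)
  also have "\<dots> = four_block_mat (S * A) (S * B) (0\<^sub>m 0 p) (0\<^sub>m 0 q)"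
    using A B S by (subst mult_four_block_mat) auto
  finally have "S * bip_mat A B * four_block_mat R1 (0\<^sub>m p q) (0\<^sub>m q p) R2
      = four_block_mat (S * A * R1) (S * B * R2) (0\<^sub>m 0 p) (0\<^sub>m 0 q)"
    using A B S R1 R2
    by (simp only:, subst mult_four_block_mat[where ?nr1.0 = m and ?n1.0 = p and ?n2.0 = q and ?nr2.0 = 0 and ?nc1.0 = p and ?nc2.0 = q])
       (auto simp del: assoc_mult_mat)
  then show ?thesis using R1 R2 by (simp add: bip_mat_def del: assoc_mult_mat)
qed

lemma rank_bip_reduces_le:
  fixes A B A' B' :: "'a::field mat"
  assumes A: "A \<in> carrier_mat m p" and B: "B \<in> carrier_mat m q" and red: "bip_reduces (A, B) (A', B')"
  shows "vec_space.rank m A' \<le> vec_space.rank m A"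
    and "vec_space.rank m B' \<le> vec_space.rank m B"
    and "vec_space.rank m (bip_mat A' B') \<le> vec_space.rank m (bip_mat A B)"
proof -
  obtain S R1 R2 where S: "S \<in> carrier_mat m m" and R1: "R1 \<in> carrier_mat p p"
    and R2: "R2 \<in> carrier_mat q q" and A': "A' = S * A * R1" and B': "B' = S * B * R2"
    using red unfolding bip_reduces_iff[OF A B] by blast
  have le: "vec_space.rank m (S * M * R) \<le> vec_space.rank m M"
    if M: "M \<in> carrier_mat m n" and R: "R \<in> carrier_mat n n" for M R n
    using rank_mult_le(1)[OF mult_carrier_mat[OF S M] R] rank_mult_le(2)[OF S M] by linarith
  show "vec_space.rank m A' \<le> vec_space.rank m A" unfolding A' by (rule le[OF A R1])
  show "vec_space.rank m B' \<le> vec_space.rank m B" unfolding B' by (rule le[OF B R2])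
  show "vec_space.rank m (bip_mat A' B') \<le> vec_space.rank m (bip_mat A B)"
    unfolding A' B' bip_mat_mult[OF A B S R1 R2]
    by (rule le[OF bip_mat_carrier[OF A B]]) (rule four_block_carrier_mat[OF R1 R2])
qed

lemma rank_canonical:
  assumes "r + s + t \<le> m" "r + s \<le> p" "r + t \<le> q"
  shows "vec_space.rank m (canonical_left m p r s :: 'a::field mat) = r + s"
    and "vec_space.rank m (canonical_right m q r s t :: 'a::field mat) = r + t"
    and "vec_space.rank m (bip_mat (canonical_left m p r s) (canonical_right m q r s t) :: 'a::field mat) = r + s + t"
proof -
  let ?L = "canonical_left m p r s :: 'a mat" and ?R = "canonical_right m q r s t :: 'a mat"
  have L: "?L \<in> carrier_mat m p" and R: "?R \<in> carrier_mat m q" by simp_all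
  note C = bip_mat_carrier[OF L R]
  have "vec_space.rank m ?L \<le> r + s"
    by (rule rank_le_nonzero_cols[OF L]) (auto simp: canonical_left_def)
  moreover have "r + s \<le> vec_space.rank m ?L"
    by (rule delta_minor_imp_le_rank[OF L, where f = id and g = id])
       (use assms in \<open>auto simp: canonical_left_def\<close>)
  ultimately show "vec_space.rank m ?L = r + s" by simp
  have "vec_space.rank m ?R \<le> r + t"
    by (rule rank_le_nonzero_cols[OF R]) (auto simp: canonical_right_def)
  \<comment> \<open>Column \<open>a\<close> of the right block has its 1 in row
    \<open>r + s + a\<close> if \<open>a < t\<close>, and in row \<open>a - t\<close> after that;
    listing the rows in this order makes the minor an identity.\<close>
  moreover have "r + t \<le> vec_space.rank m ?R"
    by (rule delta_minor_imp_le_rank[OF R, where f = "\<lambda>a. if a < t then r + s + a else a - t" and g = id])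
       (use assms in \<open>auto simp: canonical_right_def split: if_splits\<close>)
  ultimately show "vec_space.rank m ?R = r + t" by simp
  have entry: "bip_mat ?L ?R $$ (i, j) = (if j < p then (if i = j \<and> j < r + s then 1 else 0)
      else if (j - p < t \<and> i = r + s + (j - p)) \<or> (t \<le> j - p \<and> j - p < t + r \<and> t + i = j - p) then 1 else 0)"
    if "i < m" "j < p + q" for i j
    unfolding index_bip_mat[OF L R that] using that
    by (auto simp: canonical_left_def canonical_right_def)
  have "vec_space.rank m (bip_mat ?L ?R) \<le> r + s + t"
    by (rule rank_le_nonzero_rows[OF C]) (auto simp: entry)
  \<comment> \<open>The minor takes \<open>I_r\<close> and \<open>I_s\<close> from the left block
    and \<open>I_t\<close> from the right one; the second \<open>I_r\<close> lies in rows that are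
    covered already.\<close>
  moreover have "r + s + t \<le> vec_space.rank m (bip_mat ?L ?R)"
    by (rule delta_minor_imp_le_rank[OF C, where f = id and g = "\<lambda>a. if a < r + s then a else p + (a - (r + s))"])
       (use assms in \<open>auto simp: entry split: if_splits\<close>)
  ultimately show "vec_space.rank m (bip_mat ?L ?R) = r + s + t" by simp
qed

text \<open>The ranks force the parameters: \<open>r\<close> is the sum of the ranks of
  \<open>A\<close> and \<open>B\<close> minus that of \<open>[A|B]\<close>, and then
  \<open>s\<close> and \<open>t\<close> follow. Ranks cannot grow under a reduction, and reductions
  are reversible, so the canonical form has the ranks of the pair.\<close>

lemma bip_reduces_canonical_form:
  fixes A B :: "'a::field mat"
  assumes A: "A \<in> carrier_mat m p" and B: "B \<in> carrier_mat m q"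
    and "vec_space.rank m A = r + s" "vec_space.rank m B = r + t" "vec_space.rank m (bip_mat A B) = r + s + t"
  shows "bip_reduces (A, B) (canonical_left m p r s, canonical_right m q r s t)"
proof -
  obtain r' s' t' where le: "r' + s' + t' \<le> m" "r' + s' \<le> p" "r' + t' \<le> q"
    and red: "bip_reduces (A, B) (canonical_left m p r' s', canonical_right m q r' s' t')"
    using exists_canonical_form[OF A B] by blast
  have red': "bip_reduces (canonical_left m p r' s', canonical_right m q r' s' t') (A, B)"
    by (rule bip_reduces_sym[OF A B red])
  note c = canonical_left_carrier[of m p r' s', where 'a = 'a] canonical_right_carrier[of m q r' s' t', where 'a = 'a]
  have "vec_space.rank m A = r' + s'" "vec_space.rank m B = r' + t'"
    "vec_space.rank m (bip_mat A B) = r' + s' + t'"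
    using rank_bip_reduces_le[OF A B red] rank_bip_reduces_le[OF c red'] rank_canonical[OF le, where 'a = 'a]
    by simp_all
  then have "r' = r" "s' = s" "t' = t" using assms by auto
  then show ?thesis using red by simp
qed

lemma bip_reduces_if_equal_ranks:
  fixes A B A' B' :: "'a::field mat"
  assumes A: "A \<in> carrier_mat m p" and B: "B \<in> carrier_mat m q"
    and A': "A' \<in> carrier_mat m p" and B': "B' \<in> carrier_mat m q"
    and eq: "vec_space.rank m A = vec_space.rank m A'" "vec_space.rank m B = vec_space.rank m B'"
      "vec_space.rank m (bip_mat A B) = vec_space.rank m (bip_mat A' B')"
  shows "bip_reduces (A, B) (A', B')"
proof -
  obtain r s t where le: "r + s + t \<le> m" "r + s \<le> p" "r + t \<le> q"
    and red: "bip_reduces (A', B') (canonical_left m p r s, canonical_right m q r s t)"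
    using exists_canonical_form[OF A' B'] by blast
  have red': "bip_reduces (canonical_left m p r s, canonical_right m q r s t) (A', B')"
    by (rule bip_reduces_sym[OF A' B' red])
  note c = canonical_left_carrier[of m p r s, where 'a = 'a] canonical_right_carrier[of m q r s t, where 'a = 'a]
  have "bip_reduces (A, B) (canonical_left m p r s, canonical_right m q r s t)"
    by (rule bip_reduces_canonical_form[OF A B])
       (use rank_bip_reduces_le[OF A' B' red] rank_bip_reduces_le[OF c red'] rank_canonical[OF le, where 'a = 'a] eq in simp_all)
  then show ?thesis using red' by (rule bip_reduces_trans[OF A B])
qed

section \<open>Matchings\<close>

text \<open>Only the strips carrying identities prescribe where their rows and columns come from;
  the remaining indices are matched arbitrarily.\<close>

lemma exists_permutes_extension:
  assumes inj: "inj_on f {..<k}" and sub: "f ` {..<k} \<subseteq> {..<m::nat}"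
  obtains \<rho> where "\<rho> permutes {..<m}" "\<And>i. i < k \<Longrightarrow> \<rho> i = f i"
proof -
  have km: "k \<le> m" using card_inj_on_le[OF inj sub] by simp
  have "card ({..<m} - {..<k}) = card ({..<m} - f ` {..<k})"
    using km sub by (simp add: card_Diff_subset card_image[OF inj])
  then obtain h where h: "bij_betw h ({..<m} - {..<k}) ({..<m} - f ` {..<k})"
    using finite_same_card_bij[of "{..<m} - {..<k}" "{..<m} - f ` {..<k}"] by blast
  define \<rho> where "\<rho> i = (if i < k then f i else if i < m then h i else i)" for i
  have "bij_betw \<rho> {..<k} (f ` {..<k})"
    using inj by (auto simp: bij_betw_def \<rho>_def inj_on_def)
  moreover have "bij_betw \<rho> ({..<m} - {..<k}) ({..<m} - f ` {..<k})"
    by (rule bij_betw_cong[THEN iffD1, OF _ h]) (auto simp: \<rho>_def)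
  ultimately have "bij_betw \<rho> ({..<k} \<union> ({..<m} - {..<k})) (f ` {..<k} \<union> ({..<m} - f ` {..<k}))"
    by (rule bij_betw_combine) auto
  moreover have "{..<k} \<union> ({..<m} - {..<k}) = {..<m}" "f ` {..<k} \<union> ({..<m} - f ` {..<k}) = {..<m}"
    using km sub by auto
  ultimately have "\<rho> permutes {..<m}"
    using km by (intro bij_imp_permutes) (auto simp: \<rho>_def)
  then show ?thesis using that by (simp add: \<rho>_def)
qed

text \<open>\<open>N\<close> covers more columns than \<open>M\<close>, so some \<open>l\<close> in
  \<open>N\<close> has a column that is free in \<open>M\<close>. If its row is free too,
  \<open>l\<close> is added; otherwise it replaces the edge of \<open>M\<close> in that row. Either
  way covered rows stay covered, whereas a covered column may be lost. Repeated replacement walks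
  along an alternating path, and the decrease of \<open>N - M\<close> makes it end.\<close>

lemma matching_augment:
  fixes row :: "'e \<Rightarrow> 'r" and col :: "'e \<Rightarrow> 'c"
  assumes "finite M" "finite N" "inj_on row M" "inj_on col M" "inj_on row N" "inj_on col N"
    "card M < card N"
  shows "\<exists>M'. M' \<subseteq> M \<union> N \<and> inj_on row M' \<and> inj_on col M' \<and> card M' = Suc (card M) \<and> row ` M \<subseteq> row ` M'"
  using assms
proof (induction "card (N - M)" arbitrary: M rule: less_induct)
  case less
  have "card (col ` M) < card (col ` N)" using less.prems by (simp add: card_image)
  then have "\<not> col ` N \<subseteq> col ` M"
    using less.prems by (meson card_mono finite_imageI leD)
  then obtain l where l: "l \<in> N" "col l \<notin> col ` M" by auto
  then have lM: "l \<notin> M" by auto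
  show ?case
  proof (cases "row l \<in> row ` M")
    case False
    then show ?thesis using l lM less.prems
      by (intro exI[of _ "insert l M"]) auto
  next
    case True
    then obtain k where k: "k \<in> M" "row k = row l" by auto
    have kN: "k \<notin> N" using k l less.prems(5) by (metis image_eqI inj_onD)
    \<comment> \<open>Trading \<open>k\<close> for \<open>l\<close> keeps the covered rows and the size, and increases the overlap with \<open>N\<close>.\<close>
    define M1 where "M1 = insert l (M - {k})"
    have rows: "row ` M1 = row ` M" using k(1) unfolding M1_def by (auto simp: k(2)[symmetric])
    have "card M1 = Suc (card (M - {k}))"
      unfolding M1_def by (rule card_insert_disjoint) (use lM less.prems(1) in auto)
    also have "\<dots> = card M" by (rule card_Suc_Diff1[OF less.prems(1) k(1)])
    finally have card: "card M1 = card M" .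
    have "row l \<noteq> row x" if "x \<in> M - {k}" for x
      using that k less.prems(3) by (metis DiffE inj_onD singletonI)
    then have inj_row: "inj_on row M1"
      unfolding M1_def inj_on_insert using inj_on_diff[OF less.prems(3)] by blast
    have inj_col: "inj_on col M1"
      unfolding M1_def inj_on_insert using inj_on_diff[OF less.prems(4)] l(2) by blast
    have decr: "card (N - M1) < card (N - M)"
      using l(1) lM kN less.prems(2) unfolding M1_def by (intro psubset_card_mono) blast+
    have "finite M1" using less.prems(1) by (simp add: M1_def)
    moreover have "card M1 < card N" using card less.prems(7) by simp
    ultimately obtain M' where "M' \<subseteq> M1 \<union> N" "inj_on row M'" "inj_on col M'"
      "card M' = Suc (card M1)" "row ` M1 \<subseteq> row ` M'"
      using less.hyps[OF decr _ less.prems(2) inj_row inj_col less.prems(5,6)] by blast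
    moreover have "M1 \<union> N \<subseteq> M \<union> N" using l by (auto simp: M1_def)
    ultimately show ?thesis using rows card by (intro exI[of _ M']) auto
  qed
qed

lemma matching_extend:
  fixes row :: "'e \<Rightarrow> 'r" and col :: "'e \<Rightarrow> 'c"
  assumes "finite M" "finite N" "inj_on row M" "inj_on col M" "inj_on row N" "inj_on col N"
    "card M \<le> card N"
  shows "\<exists>M'. M' \<subseteq> M \<union> N \<and> inj_on row M' \<and> inj_on col M' \<and> card M' = card N \<and> row ` M \<subseteq> row ` M'"
  using assms
proof (induction "card N - card M" arbitrary: M)
  case 0
  then show ?case by (intro exI[of _ M]) auto
next
  case (Suc d)
  have "card M < card N" using Suc.hyps(2) by simp
  then obtain M1 where M1: "M1 \<subseteq> M \<union> N" "inj_on row M1" "inj_on col M1" "card M1 = Suc (card M)" "row ` M \<subseteq> row ` M1"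
    using matching_augment[of M N row col] Suc.prems by blast
  have "finite M1" using M1(1) Suc.prems by (meson finite_UnI finite_subset)
  have "d = card N - card M1" "card M1 \<le> card N"
    using Suc.hyps(2) M1(4) \<open>card M < card N\<close> by simp_all
  then obtain M' where M': "M' \<subseteq> M1 \<union> N" "inj_on row M'" "inj_on col M'" "card M' = card N" "row ` M1 \<subseteq> row ` M'"
    using Suc.hyps(1)[OF _ \<open>finite M1\<close> Suc.prems(2) M1(2,3) Suc.prems(5,6)] by blast
  have "M1 \<union> N \<subseteq> M \<union> N" using M1(1) by blast
  then show ?case
    using M'(2-4) subset_trans[OF M'(1)] subset_trans[OF M1(5) M'(5)] by blast
qed

lemma inj_on_Un_if_disjoint_images:
  "inj_on f S \<Longrightarrow> inj_on f T \<Longrightarrow> (\<And>k l. k \<in> S \<Longrightarrow> l \<in> T \<Longrightarrow> f k \<noteq> f l) \<Longrightarrow> inj_on f (S \<union> T)"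
  unfolding inj_on_def by (metis Un_iff)

section \<open>The graph of a generic bipartite matrix\<close>

locale generic_bip =
  fixes m p q :: nat and A B :: "('n::{finite,linorder}, 'a::field) mpol mat"
  assumes generic: "generic_bipartite m p q A B"
begin

lemma A_carrier: "A \<in> carrier_mat m p" and B_carrier: "B \<in> carrier_mat m q"
  using generic by (auto simp: generic_bipartite_def)

abbreviation "M \<equiv> bip_mat A B"

lemma M_carrier: "M \<in> carrier_mat m (p + q)"
  by (rule bip_mat_carrier[OF A_carrier B_carrier])

text \<open>An edge is treated as a cell of the whole matrix \<open>[A|B]\<close>, columns from
  \<open>p\<close> on belonging to \<open>B\<close>. Two edges then meet iff they agree in their row
  or in their column, and a left and a right edge can meet only in a row.\<close>

definition pos :: "'n \<Rightarrow> nat \<times> nat" where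
  "pos l = (THE ij. fst ij < m \<and> snd ij < p + q \<and> M $$ ij = unknown l)"

definition row_of :: "'n \<Rightarrow> nat" where "row_of l = fst (pos l)"
definition col_of :: "'n \<Rightarrow> nat" where "col_of l = snd (pos l)"

lemma ex1_pos: "\<exists>!ij. fst ij < m \<and> snd ij < p + q \<and> M $$ ij = unknown l"
  using generic by (simp add: generic_bipartite_def)

lemma row_of_less: "row_of l < m" and col_of_less: "col_of l < p + q"
  and M_pos: "M $$ (row_of l, col_of l) = unknown l"
  using theI'[OF ex1_pos[of l]] by (auto simp: row_of_def col_of_def pos_def)

lemma M_eq_unknown_iff:
  assumes "i < m" "j < p + q"
  shows "M $$ (i, j) = unknown l \<longleftrightarrow> i = row_of l \<and> j = col_of l"
proof
  assume "M $$ (i, j) = unknown l"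
  then have "(i, j) = (row_of l, col_of l)"
    using ex1_pos[of l] assms row_of_less[of l] col_of_less[of l] M_pos[of l] by (metis fst_conv snd_conv)
  then show "i = row_of l \<and> j = col_of l" by simp
qed (simp add: M_pos)

lemma M_cases:
  assumes "i < m" "j < p + q"
  obtains "M $$ (i, j) = 0" "\<And>l. \<not> (i = row_of l \<and> j = col_of l)"
    | l where "M $$ (i, j) = unknown l" "i = row_of l" "j = col_of l"
proof (cases "\<exists>l. M $$ (i, j) = unknown l")
  case True
  then show ?thesis using that M_eq_unknown_iff[OF assms] by blast
next
  case False
  then have "M $$ (i, j) = 0" using generic assms unfolding generic_bipartite_def by blast
  then show ?thesis using that False M_eq_unknown_iff[OF assms] by blast
qed

lemma edge_eqI: "row_of k = row_of l \<Longrightarrow> col_of k = col_of l \<Longrightarrow> k = l"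
  by (metis M_pos unknown_eq_iff)

lemma left_joins_iff: "left_joins A l i j \<longleftrightarrow> i = row_of l \<and> j = col_of l \<and> j < p"
  using A_carrier B_carrier index_bip_mat[OF A_carrier B_carrier, of i j] M_eq_unknown_iff[of i j l] row_of_less[of l]
  by (auto simp: left_joins_def)

lemma right_joins_iff: "right_joins B l i j \<longleftrightarrow> i = row_of l \<and> p + j = col_of l"
  using A_carrier B_carrier index_bip_mat[OF A_carrier B_carrier, of i "p + j"] M_eq_unknown_iff[of i "p + j" l] row_of_less[of l] col_of_less[of l]
  by (auto simp: right_joins_def)

lemma is_left_iff: "(\<exists>i j. left_joins A l i j) \<longleftrightarrow> col_of l < p"
  by (auto simp: left_joins_iff)

lemma is_right_iff: "(\<exists>i j. right_joins B l i j) \<longleftrightarrow> p \<le> col_of l"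
  by (auto simp: right_joins_iff) (metis le_Suc_ex)

lemma ends_eq: "ends A B l =
  {Row (row_of l), if col_of l < p then Minus (col_of l) else Plus (col_of l - p)}"
proof -
  have "\<Union>{{Row i, Minus j} | i j. left_joins A l i j} =
      (if col_of l < p then {Row (row_of l), Minus (col_of l)} else {})"
    by (auto simp: left_joins_iff)
  moreover have "{{Row i, Plus j} | i j. right_joins B l i j} =
      (if col_of l < p then {} else {{Row (row_of l), Plus (col_of l - p)}})"
    by (auto simp: right_joins_iff)
  ultimately show ?thesis by (simp add: ends_def)
qed

lemma Row_in_verts_iff: "Row i \<in> verts A B S \<longleftrightarrow> i \<in> row_of ` S"
  by (auto simp: verts_def ends_eq)

lemma Minus_in_verts_iff: "Minus j \<in> verts A B S \<longleftrightarrow> j < p \<and> j \<in> col_of ` S"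
  by (auto simp: verts_def ends_eq)

lemma Plus_in_verts_iff: "Plus j \<in> verts A B S \<longleftrightarrow> p + j \<in> col_of ` S"
proof
  assume "Plus j \<in> verts A B S"
  then obtain l where "l \<in> S" "\<not> col_of l < p" "j = col_of l - p"
    by (auto simp: verts_def ends_eq split: if_splits)
  then show "p + j \<in> col_of ` S" by force
next
  assume "p + j \<in> col_of ` S"
  then obtain l where "l \<in> S" "col_of l = p + j" by force
  moreover from this have "Plus j \<in> ends A B l" by (simp add: ends_eq)
  ultimately show "Plus j \<in> verts A B S" unfolding verts_def by blast
qed

lemma ends_disjoint_iff: "ends A B k \<inter> ends A B l = {} \<longleftrightarrow> row_of k \<noteq> row_of l \<and> col_of k \<noteq> col_of l"
  by (auto simp: ends_eq)

lemma matchbox_iff: "matchbox A B S \<longleftrightarrow> inj_on row_of S \<and> inj_on col_of S"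
  unfolding matchbox_def ends_disjoint_iff inj_on_def by blast

lemma left_matchbox_iff:
  "left_matchbox A B S \<longleftrightarrow> inj_on row_of S \<and> inj_on col_of S \<and> (\<forall>l\<in>S. col_of l < p)"
  by (auto simp: left_matchbox_def matchbox_iff is_left_iff)

lemma right_matchbox_iff:
  "right_matchbox A B S \<longleftrightarrow> inj_on row_of S \<and> inj_on col_of S \<and> (\<forall>l\<in>S. p \<le> col_of l)"
  by (auto simp: right_matchbox_def matchbox_iff is_right_iff)

lemma common_verts_eq:
  assumes "left_matchbox A B S" "right_matchbox A B T"
  shows "common_verts A B S T = card (row_of ` S \<inter> row_of ` T)"
proof -
  have "verts A B S \<inter> verts A B T = Row ` (row_of ` S \<inter> row_of ` T)"
  proof (rule Set.set_eqI)
    fix v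
    show "v \<in> verts A B S \<inter> verts A B T \<longleftrightarrow> v \<in> Row ` (row_of ` S \<inter> row_of ` T)"
    proof (cases v)
      case (Minus j)
      then show ?thesis using assms
        by (auto simp: Minus_in_verts_iff left_matchbox_iff right_matchbox_iff)
    next
      case (Plus j)
      then show ?thesis using assms
        by (force simp: Plus_in_verts_iff left_matchbox_iff right_matchbox_iff)
    qed (auto simp: Row_in_verts_iff)
  qed
  then show ?thesis by (simp add: common_verts_def card_image inj_on_def)
qed

lemma merge_eq:
  assumes "left_matchbox A B S" "right_matchbox A B T"
  shows "merge A B S T = S \<union> {l \<in> T. row_of l \<notin> row_of ` S}"
proof -
  have "col_of k \<noteq> col_of l" if "k \<in> S" "l \<in> T" for k l
    using that assms by (force simp: left_matchbox_iff right_matchbox_iff)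
  then have "{l \<in> T. \<exists>k\<in>S. ends A B k \<inter> ends A B l \<noteq> {}} = {l \<in> T. row_of l \<in> row_of ` S}"
    unfolding ends_disjoint_iff by (auto simp: image_iff) metis
  moreover have "S \<inter> T = {}"
    using assms by (force simp: left_matchbox_iff right_matchbox_iff)
  ultimately show ?thesis unfolding merge_def by auto
qed

lemma mu_eq: "mu A B S = det (submatrix M (row_of ` S) (col_of ` S))"
proof -
  have "{i. Row i \<in> verts A B S} = row_of ` S"
    by (simp add: Row_in_verts_iff)
  moreover have "{j. Minus j \<in> verts A B S} \<union> {dim_col A + j | j. Plus j \<in> verts A B S} = col_of ` S"
  proof (rule Set.set_eqI)
    fix j
    show "j \<in> {j. Minus j \<in> verts A B S} \<union> {dim_col A + j | j. Plus j \<in> verts A B S} \<longleftrightarrow> j \<in> col_of ` S"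
      using A_carrier by (cases "j < p") (auto simp: Minus_in_verts_iff Plus_in_verts_iff intro!: exI[of _ "j - p"])
  qed
  ultimately show ?thesis unfolding mu_def by (simp only:)
qed

section \<open>Nonzero minors versus matchboxes\<close>

lemma A_entry: "i < m \<Longrightarrow> j < p \<Longrightarrow> A $$ (i, j) = M $$ (i, j)"
  and B_entry: "i < m \<Longrightarrow> j < q \<Longrightarrow> B $$ (i, j) = M $$ (i, p + j)"
  by (simp_all add: index_bip_mat[OF A_carrier B_carrier])

text \<open>Determinants commute with \<open>h\<close>, so a minor of polynomials whose image is
  nonzero becomes a nonzero minor over the field. The index maps are the increasing enumerations of
  the covered rows and columns.\<close>

lemma mu_minor:
  fixes h :: "('n, 'a) mpol \<Rightarrow> 'k::field"
  assumes S: "matchbox A B S" and hom: "comm_ring_hom h" and nz: "h (mu A B S) \<noteq> 0"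
  obtains f g where "f ` {..<card S} \<subseteq> row_of ` S" "g ` {..<card S} \<subseteq> col_of ` S"
    "det (mat (card S) (card S) (\<lambda>(i, j). h (M $$ (f i, g j)))) \<noteq> 0"
proof -
  interpret comm_ring_hom h by (rule hom)
  let ?I = "row_of ` S" and ?J = "col_of ` S" and ?k = "card S"
  have I: "{i. i < dim_row M \<and> i \<in> ?I} = ?I" and J: "{j. j < dim_col M \<and> j \<in> ?J} = ?J"
    using M_carrier row_of_less col_of_less by auto
  have card: "card ?I = ?k" "card ?J = ?k"
    using S by (auto simp: matchbox_iff card_image)
  have sub: "submatrix M ?I ?J = mat ?k ?k (\<lambda>(i, j). M $$ (pick ?I i, pick ?J j))"
    unfolding submatrix_def I J card ..
  have "map_mat h (submatrix M ?I ?J) = mat ?k ?k (\<lambda>(i, j). h (M $$ (pick ?I i, pick ?J j)))"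
    unfolding sub by (rule eq_matI) auto
  then have "det (mat ?k ?k (\<lambda>(i, j). h (M $$ (pick ?I i, pick ?J j)))) = h (mu A B S)"
    unfolding mu_eq hom_det[symmetric] by (simp only:)
  then have "det (mat ?k ?k (\<lambda>(i, j). h (M $$ (pick ?I i, pick ?J j)))) \<noteq> 0"
    using nz by (simp only: not_False_eq_True)
  then show ?thesis
    by (rule that[rotated 2]) (use card pick_in_set_le[of _ ?I] pick_in_set_le[of _ ?J] in auto)
qed

lemma card_matchbox_le_rank:
  fixes h :: "('n, 'a) mpol \<Rightarrow> 'k::field"
  assumes S: "matchbox A B S" and hom: "comm_ring_hom h" and nz: "h (mu A B S) \<noteq> 0"
  shows "card S \<le> vec_space.rank m (map_mat h M)"
    and "left_matchbox A B S \<Longrightarrow> card S \<le> vec_space.rank m (map_mat h A)"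
    and "right_matchbox A B S \<Longrightarrow> card S \<le> vec_space.rank m (map_mat h B)"
proof -
  let ?k = "card S"
  obtain f g where f: "f ` {..<?k} \<subseteq> row_of ` S" and g: "g ` {..<?k} \<subseteq> col_of ` S"
    and det: "det (mat ?k ?k (\<lambda>(i, j). h (M $$ (f i, g j)))) \<noteq> 0"
    by (rule mu_minor[OF assms])
  have fm: "f i < m" if "i < ?k" for i using f row_of_less that by fastforce
  have gm: "g i < p + q" if "i < ?k" for i using g col_of_less that by fastforce
  have eqM: "mat ?k ?k (\<lambda>(i, j). map_mat h M $$ (f i, g j)) = mat ?k ?k (\<lambda>(i, j). h (M $$ (f i, g j)))"
    by (rule cong_mat) (use fm gm M_carrier in auto)
  show "?k \<le> vec_space.rank m (map_mat h M)"
    by (rule minor_imp_le_rank[where n = "p + q" and f = f and g = g])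
       (use M_carrier fm gm det eqM in auto)
  show "?k \<le> vec_space.rank m (map_mat h A)" if L: "left_matchbox A B S"
  proof -
    have gp: "g i < p" if "i < ?k" for i using g L that by (fastforce simp: left_matchbox_iff)
    have "mat ?k ?k (\<lambda>(i, j). map_mat h A $$ (f i, g j)) = mat ?k ?k (\<lambda>(i, j). h (M $$ (f i, g j)))"
      by (rule cong_mat) (use fm gp A_carrier in \<open>auto simp: A_entry\<close>)
    then show ?thesis
      by (intro minor_imp_le_rank[where n = p and f = f and g = g])
         (use A_carrier fm gp det in auto)
  qed
  show "?k \<le> vec_space.rank m (map_mat h B)" if R: "right_matchbox A B S"
  proof -
    have gp: "p \<le> g i" if "i < ?k" for i using g R that by (fastforce simp: right_matchbox_iff)
    have gq: "g i - p < q" if "i < ?k" for i using gm[OF that] gp[OF that] by simp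
    have "mat ?k ?k (\<lambda>(i, j). map_mat h B $$ (f i, g j - p)) = mat ?k ?k (\<lambda>(i, j). h (M $$ (f i, g j)))"
      by (rule cong_mat) (use fm gp gq B_carrier in \<open>auto simp: B_entry\<close>)
    then show ?thesis
      by (intro minor_imp_le_rank[where n = q and f = f and g = "\<lambda>j. g j - p"])
         (use B_carrier fm gq det in auto)
  qed
qed

text \<open>A surviving Leibniz term selects one nonzero entry in each row and each column of the
  minor. As \<open>h 0 = 0\<close>, each of them is the image of an unknown, so its cell is an edge.
  The bound on the columns lets a minor of \<open>A\<close> yield a left matchbox and one of
  \<open>B\<close> a right matchbox.\<close>

lemma minor_imp_matchbox:
  fixes h :: "('n, 'a) mpol \<Rightarrow> 'k::field"
  assumes f: "inj_on f {..<k}" "f ` {..<k} \<subseteq> {..<m}" and g: "inj_on g {..<k}" "g ` {..<k} \<subseteq> {..<p + q}"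
    and det: "det (mat k k (\<lambda>(i, j). h (M $$ (f i, g j)))) \<noteq> 0" and h0: "h 0 = 0"
  obtains S where "matchbox A B S" "card S = k" "col_of ` S \<subseteq> g ` {..<k}"
proof -
  let ?X = "mat k k (\<lambda>(i, j). h (M $$ (f i, g j)))"
  have "det ?X = (\<Sum>\<pi> | \<pi> permutes {0..<k}. signof \<pi> * (\<Prod>i = 0..<k. ?X $$ (i, \<pi> i)))"
    by (rule det_def') simp
  then obtain \<pi> where \<pi>: "\<pi> permutes {0..<k}" and "(\<Prod>i = 0..<k. ?X $$ (i, \<pi> i)) \<noteq> 0"
    using det by (metis (no_types, lifting) mem_Collect_eq mult_zero_right sum.neutral)
  then have nz: "?X $$ (i, \<pi> i) \<noteq> 0" if "i < k" for i using that by auto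
  have \<pi>k: "\<pi> i < k" if "i < k" for i using permutes_in_image[OF \<pi>, of i] that by simp
  have "\<exists>l. row_of l = f i \<and> col_of l = g (\<pi> i)" if i: "i < k" for i
  proof -
    have "f i < m" "g (\<pi> i) < p + q" using f g i \<pi>k by auto
    moreover have "M $$ (f i, g (\<pi> i)) \<noteq> 0" using nz[OF i] i \<pi>k[OF i] h0 by auto
    ultimately show ?thesis by (metis M_cases)
  qed
  then obtain e where e: "\<And>i. i < k \<Longrightarrow> row_of (e i) = f i \<and> col_of (e i) = g (\<pi> i)" by metis
  have row: "inj_on (row_of \<circ> e) {..<k}"
    by (rule iffD2[OF inj_on_cong f(1)]) (simp add: e)
  have "inj_on (g \<circ> \<pi>) {..<k}"
    by (rule comp_inj_on[OF inj_on_subset[OF permutes_inj[OF \<pi>]] inj_on_subset[OF g(1)]]) (use \<pi>k in auto)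
  then have "inj_on (col_of \<circ> e) {..<k}"
    by (rule iffD2[OF inj_on_cong, rotated]) (simp add: e)
  then have "matchbox A B (e ` {..<k})"
    using row by (simp add: matchbox_iff inj_on_imageI)
  moreover have "card (e ` {..<k}) = k"
    using inj_on_imageI2[OF row] by (simp add: card_image)
  moreover have "col_of ` e ` {..<k} \<subseteq> g ` {..<k}" using e \<pi>k by auto
  ultimately show ?thesis by (rule that)
qed

lemma rank_imp_matchbox:
  fixes h :: "('n, 'a) mpol \<Rightarrow> 'k::field"
  assumes h0: "h 0 = 0"
  shows "\<exists>S. matchbox A B S \<and> card S = vec_space.rank m (map_mat h M)"
    and "\<exists>S. left_matchbox A B S \<and> card S = vec_space.rank m (map_mat h A)"
    and "\<exists>S. right_matchbox A B S \<and> card S = vec_space.rank m (map_mat h B)"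
proof -
  let ?k = "vec_space.rank m (map_mat h M)"
  obtain f g where fg: "inj_on f {..<?k}" "inj_on g {..<?k}" "f ` {..<?k} \<subseteq> {..<m}" "g ` {..<?k} \<subseteq> {..<p + q}"
    "det (mat ?k ?k (\<lambda>(i, j). map_mat h M $$ (f i, g j))) \<noteq> 0"
    by (rule exists_minor[of "map_mat h M" m "p + q"]) (use M_carrier in auto)
  have "mat ?k ?k (\<lambda>(i, j). map_mat h M $$ (f i, g j)) = mat ?k ?k (\<lambda>(i, j). h (M $$ (f i, g j)))"
    by (rule cong_mat) (use fg(3,4) M_carrier in \<open>auto simp: image_subset_iff\<close>)
  then show "\<exists>S. matchbox A B S \<and> card S = ?k"
    using minor_imp_matchbox[of f ?k g h] fg h0 by metis
next
  let ?k = "vec_space.rank m (map_mat h A)"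
  obtain f g where fg: "inj_on f {..<?k}" "inj_on g {..<?k}" "f ` {..<?k} \<subseteq> {..<m}" "g ` {..<?k} \<subseteq> {..<p}"
    "det (mat ?k ?k (\<lambda>(i, j). map_mat h A $$ (f i, g j))) \<noteq> 0"
    by (rule exists_minor[of "map_mat h A" m p]) (use A_carrier in auto)
  have "mat ?k ?k (\<lambda>(i, j). map_mat h A $$ (f i, g j)) = mat ?k ?k (\<lambda>(i, j). h (M $$ (f i, g j)))"
    by (rule cong_mat) (use fg(3,4) A_carrier in \<open>auto simp: image_subset_iff A_entry\<close>)
  moreover have "g ` {..<?k} \<subseteq> {..<p + q}" using fg(4) by auto
  ultimately obtain S where "matchbox A B S" "card S = ?k" "col_of ` S \<subseteq> g ` {..<?k}"
    using minor_imp_matchbox[of f ?k g h] fg(1,2,3,5) h0 by metis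
  then show "\<exists>S. left_matchbox A B S \<and> card S = ?k"
    using fg(4) by (intro exI[of _ S]) (auto simp: matchbox_iff left_matchbox_iff)
next
  let ?k = "vec_space.rank m (map_mat h B)"
  obtain f g where fg: "inj_on f {..<?k}" "inj_on g {..<?k}" "f ` {..<?k} \<subseteq> {..<m}" "g ` {..<?k} \<subseteq> {..<q}"
    "det (mat ?k ?k (\<lambda>(i, j). map_mat h B $$ (f i, g j))) \<noteq> 0"
    by (rule exists_minor[of "map_mat h B" m q]) (use B_carrier in auto)
  have "mat ?k ?k (\<lambda>(i, j). map_mat h B $$ (f i, g j)) = mat ?k ?k (\<lambda>(i, j). h (M $$ (f i, p + g j)))"
    by (rule cong_mat) (use fg(3,4) B_carrier in \<open>auto simp: image_subset_iff B_entry\<close>)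
  moreover have "(\<lambda>j. p + g j) ` {..<?k} \<subseteq> {..<p + q}" "inj_on (\<lambda>j. p + g j) {..<?k}"
    using fg(2,4) by (auto simp: inj_on_def)
  ultimately obtain S where "matchbox A B S" "card S = ?k" "col_of ` S \<subseteq> (\<lambda>j. p + g j) ` {..<?k}"
    using minor_imp_matchbox[of f ?k "\<lambda>j. p + g j" h] fg(1,3,5) h0 by metis
  then show "\<exists>S. right_matchbox A B S \<and> card S = ?k"
    by (intro exI[of _ S]) (auto simp: matchbox_iff right_matchbox_iff)
qed

section \<open>Largest matchboxes and the optimal pair\<close>

text \<open>The enlarged matchbox uses edges of \<open>S\<close> and \<open>T\<close> only, so it is
  again left, and it has the size of the largest one \<open>T\<close>.\<close>

lemma largest_left_extend:
  assumes "left_matchbox A B S" "largest_left A B T"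
  shows "\<exists>T'. largest_left A B T' \<and> row_of ` S \<subseteq> row_of ` T'"
proof -
  have le: "card S \<le> card T" and T: "left_matchbox A B T" using assms by (auto simp: largest_left_def)
  obtain T' where T': "T' \<subseteq> S \<union> T" "inj_on row_of T'" "inj_on col_of T'" "card T' = card T" "row_of ` S \<subseteq> row_of ` T'"
    using matching_extend[of S T row_of col_of] assms(1) T le by (auto simp: left_matchbox_iff)
  then have "left_matchbox A B T'" using assms(1) T by (auto simp: left_matchbox_iff)
  then show ?thesis using T'(4,5) assms(2) by (auto simp: largest_left_def)
qed

lemma largest_right_extend:
  assumes "right_matchbox A B S" "largest_right A B T"
  shows "\<exists>T'. largest_right A B T' \<and> row_of ` S \<subseteq> row_of ` T'"
proof -
  have le: "card S \<le> card T" and T: "right_matchbox A B T" using assms by (auto simp: largest_right_def)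
  obtain T' where T': "T' \<subseteq> S \<union> T" "inj_on row_of T'" "inj_on col_of T'" "card T' = card T" "row_of ` S \<subseteq> row_of ` T'"
    using matching_extend[of S T row_of col_of] assms(1) T le by (auto simp: right_matchbox_iff)
  then have "right_matchbox A B T'" using assms(1) T by (auto simp: right_matchbox_iff)
  then show ?thesis using T'(4,5) assms(2) by (auto simp: largest_right_def)
qed

lemma common_verts_le:
  assumes "left_matchbox A B S" "right_matchbox A B T"
  shows "common_verts A B S T \<le> card S" "common_verts A B S T \<le> card T"
proof -
  have "card (row_of ` S \<inter> row_of ` T) \<le> card (row_of ` S)"
    "card (row_of ` S \<inter> row_of ` T) \<le> card (row_of ` T)"
    by (rule card_mono; simp)+
  then show "common_verts A B S T \<le> card S" "common_verts A B S T \<le> card T"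
    unfolding common_verts_eq[OF assms]
    using card_image_le[of S row_of] card_image_le[of T row_of] by simp_all
qed

lemma card_matchbox_le_optimal:
  assumes opt: "optimal_pair A B S T" and U: "matchbox A B U"
  shows "card U + common_verts A B S T \<le> card S + card T"
proof -
  define UL where "UL = {l \<in> U. col_of l < p}"
  define UR where "UR = {l \<in> U. p \<le> col_of l}"
  have U_eq: "U = UL \<union> UR" by (auto simp: UL_def UR_def)
  have inj: "inj_on row_of U" "inj_on col_of U" using U by (auto simp: matchbox_iff)
  have "left_matchbox A B UL" "right_matchbox A B UR"
    using inj by (auto simp: left_matchbox_iff right_matchbox_iff UL_def UR_def intro: inj_on_subset)
  then obtain S' T' where S': "largest_left A B S'" "row_of ` UL \<subseteq> row_of ` S'"
    and T': "largest_right A B T'" "row_of ` UR \<subseteq> row_of ` T'"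
    using largest_left_extend[of UL S] largest_right_extend[of UR T] opt unfolding optimal_pair_def by metis
  have LR: "left_matchbox A B S'" "right_matchbox A B T'"
    using S' T' by (auto simp: largest_left_def largest_right_def)
  have "row_of ` U \<subseteq> row_of ` S' \<union> row_of ` T'" using S' T' U_eq by auto
  then have "card U \<le> card (row_of ` S' \<union> row_of ` T')"
    using card_mono[of "row_of ` S' \<union> row_of ` T'" "row_of ` U"] card_image[OF inj(1)] by simp
  \<comment> \<open>Inclusion-exclusion trades the union of the rows for their intersection, whose
    size is \<open>v(S', T')\<close> and is bounded below by optimality.\<close>
  moreover have "card (row_of ` S' \<union> row_of ` T') + card (row_of ` S' \<inter> row_of ` T') = card S' + card T'"
    using card_Un_Int[of "row_of ` S'" "row_of ` T'"] LR
    by (simp add: card_image left_matchbox_iff right_matchbox_iff)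
  moreover have "common_verts A B S T \<le> card (row_of ` S' \<inter> row_of ` T')"
    using opt S'(1) T'(1) unfolding optimal_pair_def common_verts_eq[OF LR, symmetric] by blast
  moreover have "card S' = card S" "card T' = card T"
    using opt S'(1) T'(1) by (meson le_antisym largest_left_def largest_right_def optimal_pair_def)+
  ultimately show ?thesis by linarith
qed

text \<open>Every common row carries exactly one edge of \<open>T\<close>, and these are the edges
  dropped. The merged matchbox thus attains the bound of
  \<open>card_matchbox_le_optimal\<close>.\<close>

lemma matchbox_merge:
  assumes S: "left_matchbox A B S" and T: "right_matchbox A B T"
  shows "matchbox A B (merge A B S T)"
    and "card (merge A B S T) + common_verts A B S T = card S + card T"
proof -
  let ?T' = "{l \<in> T. row_of l \<notin> row_of ` S}"
  have inj: "inj_on row_of S" "inj_on row_of ?T'" "inj_on col_of S" "inj_on col_of ?T'"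
    using S T by (auto simp: left_matchbox_iff right_matchbox_iff intro: inj_on_subset)
  have col: "col_of k \<noteq> col_of l" if "k \<in> S" "l \<in> T" for k l
    using that S T by (force simp: left_matchbox_iff right_matchbox_iff)
  have row: "row_of k \<noteq> row_of l" if "k \<in> S" "l \<in> ?T'" for k l
  proof -
    have "row_of l \<notin> row_of ` S" using that(2) by simp
    then show ?thesis using imageI[OF that(1), of row_of] by metis
  qed
  have "inj_on row_of (S \<union> ?T')"
    by (rule inj_on_Un_if_disjoint_images[OF inj(1,2) row])
  moreover have "inj_on col_of (S \<union> ?T')"
    by (rule inj_on_Un_if_disjoint_images[OF inj(3,4) col]) simp_all
  ultimately show "matchbox A B (merge A B S T)"
    by (simp add: merge_eq[OF S T] matchbox_iff)
  have "card (S \<union> ?T') = card S + card ?T'"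
    by (rule card_Un_disjoint) auto
  moreover have "card T = card ?T' + card {l \<in> T. row_of l \<in> row_of ` S}"
    by (subst card_Un_disjoint[symmetric]) (auto intro: arg_cong[where f = card])
  moreover have "row_of ` {l \<in> T. row_of l \<in> X} = X \<inter> row_of ` T" for X by auto
  then have "card {l \<in> T. row_of l \<in> row_of ` S} = common_verts A B S T"
    using card_image[OF inj_on_subset[of row_of T "{l \<in> T. row_of l \<in> row_of ` S}"]] T
    by (simp add: common_verts_eq[OF S T] right_matchbox_iff)
  ultimately show "card (merge A B S T) + common_verts A B S T = card S + card T"
    by (simp add: merge_eq[OF S T])
qed

text \<open>The three matchboxes bound the ranks from below through their minors. A matchbox of size
  equal to a rank cannot be larger than they are, by maximality for \<open>A\<close> and
  \<open>B\<close> and by \<open>card_matchbox_le_optimal\<close> for \<open>M\<close>.\<close>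

lemma rank_optimal_pair:
  fixes h :: "('n, 'a) mpol \<Rightarrow> 'k::field"
  assumes opt: "optimal_pair A B S T" and hom: "comm_ring_hom h"
    and nz: "h (mu A B S) \<noteq> 0" "h (mu A B T) \<noteq> 0" "h (mu A B (merge A B S T)) \<noteq> 0"
  shows "vec_space.rank m (map_mat h A) = card S"
    and "vec_space.rank m (map_mat h B) = card T"
    and "vec_space.rank m (map_mat h M) + common_verts A B S T = card S + card T"
proof -
  interpret comm_ring_hom h by (rule hom)
  have S: "left_matchbox A B S" and T: "right_matchbox A B T"
    using opt by (auto simp: optimal_pair_def largest_left_def largest_right_def)
  have ST: "matchbox A B S" "matchbox A B T"
    using S T by (auto simp: left_matchbox_def right_matchbox_def)
  have "vec_space.rank m (map_mat h A) \<le> card S"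
    using rank_imp_matchbox(2)[of h] opt by (auto simp: optimal_pair_def largest_left_def)
  then show "vec_space.rank m (map_mat h A) = card S"
    using card_matchbox_le_rank(2)[OF ST(1) hom nz(1) S] by simp
  have "vec_space.rank m (map_mat h B) \<le> card T"
    using rank_imp_matchbox(3)[of h] opt by (auto simp: optimal_pair_def largest_right_def)
  then show "vec_space.rank m (map_mat h B) = card T"
    using card_matchbox_le_rank(3)[OF ST(2) hom nz(2) T] by simp
  have "vec_space.rank m (map_mat h M) + common_verts A B S T \<le> card S + card T"
    using rank_imp_matchbox(1)[of h] card_matchbox_le_optimal[OF opt] by (metis hom_zero)
  then show "vec_space.rank m (map_mat h M) + common_verts A B S T = card S + card T"
    using card_matchbox_le_rank(1)[OF matchbox_merge(1)[OF S T] hom nz(3)] matchbox_merge(2)[OF S T] by linarith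
qed

section \<open>Specialization at a characteristic vector\<close>

text \<open>The condition \<open>only\<close> excludes further edges of \<open>T\<close> from the
  rows and columns covered by \<open>S\<close>, so the specialized submatrix has ones exactly in the
  cells of \<open>S\<close>: it is a permutation matrix.\<close>

lemma mpol_eval_char_vec_mu:
  assumes S: "matchbox A B S" and ST: "S \<subseteq> T"
    and only: "\<And>l. l \<in> T \<Longrightarrow> row_of l \<in> row_of ` S \<Longrightarrow> col_of l \<in> col_of ` S \<Longrightarrow> l \<in> S"
  shows "mpol_eval (char_vec T) (mu A B S) \<noteq> 0"
proof -
  let ?h = "mpol_eval (char_vec T :: 'n \<Rightarrow> 'a)"
  interpret comm_ring_hom ?h by (rule comm_ring_hom_mpol_eval)
  let ?I = "row_of ` S" and ?J = "col_of ` S" and ?k = "card S"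
  let ?X = "submatrix M ?I ?J"
  \<comment> \<open>\<open>f l\<close> and \<open>g l\<close> are the positions of the row and the
    column of \<open>l\<close> inside the submatrix, whose indices increase.\<close>
  define f where "f l = card {x \<in> ?I. x < row_of l}" for l
  define g where "g l = card {x \<in> ?J. x < col_of l}" for l
  have inj: "inj_on row_of S" "inj_on col_of S" using S by (auto simp: matchbox_iff)
  have IJ: "{i. i < dim_row M \<and> i \<in> ?I} = ?I" "{j. j < dim_col M \<and> j \<in> ?J} = ?J"
    using M_carrier row_of_less col_of_less by auto
  have X: "?X \<in> carrier_mat ?k ?k"
    by (rule carrier_matI) (simp_all only: dim_submatrix IJ card_image[OF inj(1)] card_image[OF inj(2)])
  have f: "f l < ?k" if "l \<in> S" for l
    unfolding f_def card_image[OF inj(1), symmetric] by (rule psubset_card_mono) (use that in auto)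
  have g: "g l < ?k" if "l \<in> S" for l
    unfolding g_def card_image[OF inj(2), symmetric] by (rule psubset_card_mono) (use that in auto)
  have entry: "map_mat ?h ?X $$ (f l, g l') = (if l = l' then 1 else 0)" if l: "l \<in> S" "l' \<in> S" for l l'
  proof -
    have "?X $$ (f l, g l') = M $$ (row_of l, col_of l')"
      unfolding f_def g_def by (rule submatrix_index_card) (use l M_carrier row_of_less col_of_less in auto)
    then have eq: "map_mat ?h ?X $$ (f l, g l') = ?h (M $$ (row_of l, col_of l'))"
      using f[OF l(1)] g[OF l(2)] X by simp
    show ?thesis
    proof (cases rule: M_cases[OF row_of_less[of l] col_of_less[of l']])
      case 1
      then have "l \<noteq> l'" by auto
      then show ?thesis using eq 1 by simp
    next
      case (2 x)
      have "x \<in> S \<longleftrightarrow> l = l'"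
      proof
        assume "x \<in> S"
        then have "x = l" "x = l'" using 2 l inj by (auto dest: inj_onD)
        then show "l = l'" by simp
      next
        assume "l = l'"
        then show "x \<in> S" using edge_eqI[of l x] 2 l by simp
      qed
      moreover have "x \<in> T \<longleftrightarrow> x \<in> S"
        using ST only[of x] l 2(2,3) by (metis image_eqI subsetD)
      ultimately show ?thesis using eq 2(1) by (simp add: char_vec_def)
    qed
  qed
  \<comment> \<open>Listing rows and columns along a common enumeration of \<open>S\<close> turns
    the permutation matrix into an identity, so that full rank replaces the computation of a
    sign.\<close>
  obtain e where e: "bij_betw e {..<?k} S"
    using ex_bij_betw_nat_finite[of S] by (auto simp: lessThan_atLeast0)
  have eS: "e i \<in> S" if "i < ?k" for i using e that by (auto simp: bij_betw_def)
  have "?k \<le> vec_space.rank ?k (map_mat ?h ?X)"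
  proof (rule delta_minor_imp_le_rank[where n = ?k and f = "f \<circ> e" and g = "g \<circ> e"])
    show "map_mat ?h ?X $$ ((f \<circ> e) i, (g \<circ> e) j) = (if i = j then 1 else 0)" if "i < ?k" "j < ?k" for i j
      using entry[OF eS eS] that e by (auto simp: bij_betw_def inj_on_def)
  qed (use X f g eS in auto)
  moreover have hX: "map_mat ?h ?X \<in> carrier_mat ?k ?k" using X by simp
  ultimately have "det (map_mat ?h ?X) \<noteq> 0"
    using vec_space.rank_le_nc[OF hX] vec_space.det_rank_iff[OF hX] by simp
  then show ?thesis unfolding mu_eq hom_det .
qed

lemma eval_char_vec_entry:
  assumes "i < m" "j < p + q"
  shows "mpol_eval (char_vec T) (M $$ (i, j)) = (if \<exists>l\<in>T. row_of l = i \<and> col_of l = j then 1 else 0)"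
proof (cases rule: M_cases[OF assms])
  case 1
  then show ?thesis by auto
next
  case (2 x)
  then have "(\<exists>l\<in>T. row_of l = i \<and> col_of l = j) \<longleftrightarrow> x \<in> T"
    using edge_eqI[of _ x] by metis
  then show ?thesis using 2(1) by (simp add: char_vec_def)
qed

text \<open>The rows are ordered by kind: common to both matchboxes, covered by \<open>S\<close>
  only, covered by \<open>T\<close> only, uncovered. The columns follow the edges in these
  rows.\<close>

lemma canonical_up_to_perm_char_vec:
  assumes S: "left_matchbox A B S" and T: "right_matchbox A B T"
    and r: "r = common_verts A B S T" and s: "card S = r + s" and t: "card T = r + t"
  shows "canonical_up_to_perm m p q r s t (bip_subst A B (char_vec (S \<union> T)))"
proof -
  have S': "inj_on row_of S" "inj_on col_of S" "\<And>l. l \<in> S \<Longrightarrow> col_of l < p"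
    and T': "inj_on row_of T" "inj_on col_of T" "\<And>l. l \<in> T \<Longrightarrow> p \<le> col_of l"
    using S T by (auto simp: left_matchbox_iff right_matchbox_iff)
  define RS RT where "RS = row_of ` S" and "RT = row_of ` T"
  have cRST: "card (RS \<inter> RT) = r" unfolding r common_verts_eq[OF S T] RS_def RT_def ..
  define S0 T0 where "S0 = {l \<in> S. row_of l \<in> RT}" and "T0 = {l \<in> T. row_of l \<in> RS}"
  have img: "f ` {l \<in> U. f l \<in> X} = X \<inter> f ` U" for f :: "'n \<Rightarrow> nat" and U X by auto
  have "card S0 = r"
    using card_image[OF inj_on_subset[OF S'(1), of S0]] cRST img[of row_of S RT]
    by (simp add: S0_def RS_def Int_commute)
  moreover have "card T0 = r"
    using card_image[OF inj_on_subset[OF T'(1), of T0]] cRST img[of row_of T RS]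
    by (simp add: T0_def RT_def)
  ultimately have "card (S - S0) = s" "card (T - T0) = t"
    using s t by (simp_all add: card_Diff_subset S0_def T0_def)
  then obtain e0 e1 d1 where e0: "bij_betw e0 {..<r} S0" and e1: "bij_betw e1 {..<s} (S - S0)"
    and d1: "bij_betw d1 {..<t} (T - T0)"
    using \<open>card S0 = r\<close> finite_same_card_bij[of "{..<r}" S0] finite_same_card_bij[of "{..<s}" "S - S0"]
      finite_same_card_bij[of "{..<t}" "T - T0"] by auto
  have e0': "e0 i \<in> S" "row_of (e0 i) \<in> RT" if "i < r" for i
    using bij_betwE[OF e0] that by (auto simp: S0_def)
  have e1': "e1 i \<in> S" "e1 i \<notin> S0" if "i < s" for i
    using bij_betwE[OF e1] that by auto
  have d1': "d1 i \<in> T" "row_of (d1 i) \<notin> RS" if "i < t" for i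
    using bij_betwE[OF d1] that by (auto simp: T0_def)
  \<comment> \<open>\<open>d0 i\<close> is the partner of \<open>e0 i\<close> in the same row; the
    pairing puts the two copies of \<open>I_r\<close> into the same rows in the same order.\<close>
  have "\<exists>l\<in>T. row_of l = row_of (e0 i)" if "i < r" for i
    using e0'(2)[OF that] unfolding RT_def by (metis imageE)
  then obtain d0 where d0: "\<And>i. i < r \<Longrightarrow> d0 i \<in> T \<and> row_of (d0 i) = row_of (e0 i)" by metis
  \<comment> \<open>\<open>a\<close> and \<open>b\<close> list the edges in the order of the
    canonical columns. The right block starts with \<open>I_t\<close>, so \<open>b\<close> starts
    with the edges of \<open>T\<close> that have no partner.\<close>
  define a where "a x = (if x < r then e0 x else e1 (x - r))" for x
  define b where "b y = (if y < t then d1 y else d0 (y - t))" for y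
  have aS: "a x \<in> S" if "x < r + s" for x using that e0' e1' by (auto simp: a_def)
  have bT: "b y \<in> T" if "y < t + r" for y using that d0 d1' by (auto simp: b_def)
  have a_inj: "inj_on a {..<r + s}"
  proof (rule inj_onI)
    fix x y assume xy: "x \<in> {..<r + s}" "y \<in> {..<r + s}" "a x = a y"
    have S0: "a z \<in> S0 \<longleftrightarrow> z < r" if "z < r + s" for z
      using that bij_betwE[OF e0] e1' by (auto simp: a_def)
    show "x = y"
    proof (cases "x < r")
      case True
      then have "y < r" using S0[of x] S0[of y] xy by simp
      then show ?thesis using True xy(3) bij_betw_imp_inj_on[OF e0] by (auto simp: a_def dest: inj_onD)
    next
      case False
      then have "\<not> y < r" using S0[of x] S0[of y] xy by simp
      moreover from this have "x - r = y - r"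
        using False xy inj_onD[OF bij_betw_imp_inj_on[OF e1], of "x - r" "y - r"] by (auto simp: a_def)
      ultimately show ?thesis using False by simp
    qed
  qed
  \<comment> \<open>\<open>h y\<close> is the row of the 1 in column \<open>y\<close> of
    \<open>canonical_right\<close>, and \<open>f\<close> lists the actual rows in the order of the
    strips.\<close>
  define h where "h y = (if y < t then r + s + y else y - t)" for y
  define f where "f x = (if x < r + s then row_of (a x) else row_of (d1 (x - (r + s))))" for x
  have f_inj: "inj_on f {..<r + s + t}"
  proof (rule inj_onI)
    fix x y assume xy: "x \<in> {..<r + s + t}" "y \<in> {..<r + s + t}" "f x = f y"
    have RS: "f z \<in> RS \<longleftrightarrow> z < r + s" if "z < r + s + t" for z
      using that aS d1'(2)[of "z - (r + s)"] by (auto simp: f_def RS_def)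
    show "x = y"
    proof (cases "x < r + s")
      case True
      then have "y < r + s" using RS[of x] RS[of y] xy by simp
      then show ?thesis using True xy(3) inj_onD[OF S'(1) _ aS aS] inj_onD[OF a_inj] by (auto simp: f_def)
    next
      case False
      then have y: "\<not> y < r + s" using RS[of x] RS[of y] xy by simp
      then have "d1 (x - (r + s)) = d1 (y - (r + s))"
        using False xy d1'(1) by (intro inj_onD[OF T'(1)]) (auto simp: f_def)
      then have "x - (r + s) = y - (r + s)"
        by (rule inj_onD[OF bij_betw_imp_inj_on[OF d1]]) (use xy False y in auto)
      then show ?thesis using False y by simp
    qed
  qed
  have row_b: "row_of (b y) = f (h y)" if "y < t + r" for y
    using that d0[of "y - t"] by (auto simp: b_def f_def h_def a_def)
  have h_less: "h y < r + s + t" if "y < t + r" for y using that by (auto simp: h_def)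
  have h_inj: "inj_on h {..<t + r}" by (auto simp: inj_on_def h_def)
  \<comment> \<open>An edge of \<open>T\<close> is recognized by its row here, so injectivity of
    \<open>f\<close> and \<open>h\<close> covers the partners \<open>d0\<close> as well.\<close>
  have b_inj: "inj_on b {..<t + r}"
  proof (rule inj_onI)
    fix x y assume xy: "x \<in> {..<t + r}" "y \<in> {..<t + r}" "b x = b y"
    then have "f (h x) = f (h y)" using row_b by (metis lessThan_iff)
    then have "h x = h y" using inj_onD[OF f_inj] h_less xy by simp
    then show "x = y" using inj_onD[OF h_inj] xy by blast
  qed
  have a_img: "a ` {..<r + s} = S"
    by (rule card_subset_eq) (use aS card_image[OF a_inj] s in auto)
  have b_img: "b ` {..<t + r} = T"
    by (rule card_subset_eq) (use bT card_image[OF b_inj] t in auto)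

  have f_sub: "f ` {..<r + s + t} \<subseteq> {..<m}"
    using row_of_less by (auto simp: f_def)
  have "r + s + t \<le> m" using card_inj_on_le[OF f_inj f_sub] by simp
  obtain \<rho> where \<rho>: "\<rho> permutes {..<m}" "\<And>i. i < r + s + t \<Longrightarrow> \<rho> i = f i"
    using exists_permutes_extension[OF f_inj f_sub] by metis
  have col_inj: "inj_on (\<lambda>x. col_of (a x)) {..<r + s}"
    using comp_inj_on[OF a_inj] S'(2) a_img by (simp add: comp_def)
  have col_sub: "(\<lambda>x. col_of (a x)) ` {..<r + s} \<subseteq> {..<p}"
    using S'(3) aS by auto
  have "r + s \<le> p" using card_inj_on_le[OF col_inj col_sub] by simp
  obtain \<sigma> where \<sigma>: "\<sigma> permutes {..<p}" "\<And>i. i < r + s \<Longrightarrow> \<sigma> i = col_of (a i)"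
    using exists_permutes_extension[OF col_inj col_sub] by metis
  have "inj_on (\<lambda>l. col_of l - p) T"
    using T'(2,3) by (intro inj_onI) (metis inj_onD le_add_diff_inverse)
  then have col_inj': "inj_on (\<lambda>y. col_of (b y) - p) {..<t + r}"
    using comp_inj_on[OF b_inj, of "\<lambda>l. col_of l - p"] b_img by (simp add: comp_def)
  have col_sub': "(\<lambda>y. col_of (b y) - p) ` {..<t + r} \<subseteq> {..<q}"
  proof (rule image_subsetI)
    fix y assume "y \<in> {..<t + r}"
    then have "p \<le> col_of (b y)" using T'(3) bT by simp
    then show "col_of (b y) - p \<in> {..<q}" using col_of_less[of "b y"] by simp
  qed
  have "r + t \<le> q" using card_inj_on_le[OF col_inj' col_sub'] by simp
  obtain \<tau> where \<tau>: "\<tau> permutes {..<q}" "\<And>i. i < t + r \<Longrightarrow> \<tau> i = col_of (b i) - p"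
    using exists_permutes_extension[OF col_inj' col_sub'] by metis
  have col_b: "col_of (b y) = p + \<tau> y" if "y < t + r" for y
    using \<tau>(2)[OF that] T'(3)[OF bT[OF that]] by simp
  have \<rho>m: "\<rho> i < m" if "i < m" for i using permutes_in_image[OF \<rho>(1), of i] that by simp
  have \<sigma>p: "\<sigma> i < p" if "i < p" for i using permutes_in_image[OF \<sigma>(1), of i] that by simp
  have \<tau>q: "\<tau> i < q" if "i < q" for i using permutes_in_image[OF \<tau>(1), of i] that by simp

  have left: "(\<exists>l\<in>S \<union> T. row_of l = \<rho> i \<and> col_of l = \<sigma> j) \<longleftrightarrow> i = j \<and> j < r + s" if ij: "i < m" "j < p" for i j
  proof
    assume "\<exists>l\<in>S \<union> T. row_of l = \<rho> i \<and> col_of l = \<sigma> j"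
    then obtain l where l: "l \<in> S \<union> T" "row_of l = \<rho> i" "col_of l = \<sigma> j" by blast
    then have "l \<in> S" using T'(3)[of l] \<sigma>p[OF ij(2)] by fastforce
    then obtain x where x: "x < r + s" "l = a x" using a_img by auto
    have "\<sigma> x = \<sigma> j" using \<sigma>(2)[OF x(1)] x(2) l(3) by simp
    then have "x = j" using permutes_inj[OF \<sigma>(1)] by (simp add: inj_eq)
    have "\<rho> x = \<rho> i" using \<rho>(2)[of x] x l(2) by (simp add: f_def)
    then have "x = i" using permutes_inj[OF \<rho>(1)] by (simp add: inj_eq)
    then show "i = j \<and> j < r + s" using \<open>x = j\<close> x(1) by simp
  next
    assume "i = j \<and> j < r + s"
    then show "\<exists>l\<in>S \<union> T. row_of l = \<rho> i \<and> col_of l = \<sigma> j"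
      using aS[of j] \<rho>(2)[of j] \<sigma>(2)[of j] by (intro bexI[of _ "a j"]) (auto simp: f_def)
  qed
  have right: "(\<exists>l\<in>S \<union> T. row_of l = \<rho> i \<and> col_of l = p + \<tau> j) \<longleftrightarrow> j < t + r \<and> i = h j" if ij: "i < m" "j < q" for i j
  proof
    assume "\<exists>l\<in>S \<union> T. row_of l = \<rho> i \<and> col_of l = p + \<tau> j"
    then obtain l where l: "l \<in> S \<union> T" "row_of l = \<rho> i" "col_of l = p + \<tau> j" by blast
    then have "l \<in> T" using S'(3)[of l] by fastforce
    then obtain y where y: "y < t + r" "l = b y" using b_img by auto
    have "\<tau> y = \<tau> j" using col_b[OF y(1)] y(2) l(3) by simp
    then have "y = j" using permutes_inj[OF \<tau>(1)] by (simp add: inj_eq)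
    have "\<rho> (h y) = \<rho> i" using \<rho>(2)[OF h_less[OF y(1)]] row_b[OF y(1)] y(2) l(2) by simp
    then have "h y = i" using permutes_inj[OF \<rho>(1)] by (simp add: inj_eq)
    then show "j < t + r \<and> i = h j" using \<open>y = j\<close> y(1) by simp
  next
    assume "j < t + r \<and> i = h j"
    then show "\<exists>l\<in>S \<union> T. row_of l = \<rho> i \<and> col_of l = p + \<tau> j"
      using bT[of j] row_b[of j] \<rho>(2)[OF h_less[of j]] col_b[of j] by (intro bexI[of _ "b j"]) auto
  qed
  let ?e = "mpol_eval (char_vec (S \<union> T) :: 'n \<Rightarrow> 'a)"
  have "permute_mat \<rho> \<sigma> (map_mat ?e A) = canonical_left m p r s"
  proof (rule eq_matI)
    fix i j assume "i < dim_row (canonical_left m p r s :: 'a mat)" "j < dim_col (canonical_left m p r s :: 'a mat)"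
    then have ij: "i < m" "j < p" by (auto simp: canonical_left_def)
    have "permute_mat \<rho> \<sigma> (map_mat ?e A) $$ (i, j) = ?e (M $$ (\<rho> i, \<sigma> j))"
      using ij \<rho>m \<sigma>p A_carrier by (simp add: permute_mat_def A_entry)
    also have "\<dots> = (if i = j \<and> j < r + s then 1 else 0)"
      using eval_char_vec_entry[of "\<rho> i" "\<sigma> j" "S \<union> T"] \<rho>m[OF ij(1)] \<sigma>p[OF ij(2)] left[OF ij]
      by (simp only: trans_less_add1)
    finally show "permute_mat \<rho> \<sigma> (map_mat ?e A) $$ (i, j) = canonical_left m p r s $$ (i, j)"
      using ij by (simp add: canonical_left_def)
  qed (use A_carrier in \<open>simp_all add: permute_mat_def canonical_left_def\<close>)
  moreover have "permute_mat \<rho> \<tau> (map_mat ?e B) = canonical_right m q r s t"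
  proof (rule eq_matI)
    fix i j assume "i < dim_row (canonical_right m q r s t :: 'a mat)" "j < dim_col (canonical_right m q r s t :: 'a mat)"
    then have ij: "i < m" "j < q" by (auto simp: canonical_right_def)
    have "permute_mat \<rho> \<tau> (map_mat ?e B) $$ (i, j) = ?e (M $$ (\<rho> i, p + \<tau> j))"
      using ij \<rho>m \<tau>q B_carrier by (simp add: permute_mat_def B_entry)
    also have "\<dots> = (if j < t + r \<and> i = h j then 1 else 0)"
      using eval_char_vec_entry[of "\<rho> i" "p + \<tau> j" "S \<union> T"] \<rho>m[OF ij(1)] \<tau>q[OF ij(2)] right[OF ij]
      by (simp only: add_less_cancel_left)
    also have "\<dots> = canonical_right m q r s t $$ (i, j)"
      using ij by (auto simp: canonical_right_def h_def)
    finally show "permute_mat \<rho> \<tau> (map_mat ?e B) $$ (i, j) = canonical_right m q r s t $$ (i, j)" .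
  qed (use B_carrier in \<open>simp_all add: permute_mat_def canonical_right_def\<close>)
  ultimately show ?thesis
    unfolding canonical_up_to_perm_def bip_subst_def fst_conv snd_conv
    using \<open>r + s + t \<le> m\<close> \<open>r + s \<le> p\<close> \<open>r + t \<le> q\<close> \<rho>(1) \<sigma>(1) \<tau>(1) by blast
qed

end

theorem theorem2:
  fixes A B :: "('n::{finite,linorder}, 'a::field) mpol mat"
    and f :: "('n, 'a) mpol"
    and m p q :: nat
    and \<A> \<B> :: "'n set"
  assumes "generic_bipartite m p q A B"
    and "optimal_pair A B \<A> \<B>"
    and "is_LCM f {mu A B \<A>, mu A B \<B>, mu A B (merge A B \<A> \<B>)}"
  shows "f \<noteq> 0 \<and>
    (\<forall>N \<in> bip_family A B f. bip_reduces N (bip_subst A B (char_vec (\<A> \<union> \<B>)))) \<and>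
    bip_subst A B (char_vec (\<A> \<union> \<B>)) \<in> bip_family A B f \<and>
    (\<exists>r s t. r = common_verts A B \<A> \<B> \<and> card \<A> = r + s \<and> card \<B> = r + t \<and>
       canonical_up_to_perm m p q r s t (bip_subst A B (char_vec (\<A> \<union> \<B>))) \<and>
       r + s = rank_K A \<and> r + t = rank_K B \<and> r + s + t = rank_K (bip_mat A B))"
proof -
  interpret generic_bip m p q A B by unfold_locales (rule assms(1))
  let ?C = "merge A B \<A> \<B>" and ?e = "char_vec (\<A> \<union> \<B>) :: 'n \<Rightarrow> 'a"
  have L: "left_matchbox A B \<A>" and R: "right_matchbox A B \<B>"
    using assms(2) by (auto simp: optimal_pair_def largest_left_def largest_right_def)
  have LR: "col_of k \<noteq> col_of l" if "k \<in> \<A>" "l \<in> \<B>" for k l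
    using that L R by (force simp: left_matchbox_iff right_matchbox_iff)
  have matchbox: "matchbox A B \<A>" "matchbox A B \<B>" "matchbox A B ?C"
    using L R matchbox_merge(1)[OF L R] by (auto simp: left_matchbox_def right_matchbox_def)
  \<comment> \<open>An edge of \<open>\<B>\<close> never lies in a column of \<open>\<A>\<close>, so
    among the edges in the rows and columns of \<open>\<A>\<close> the vector selects those of
    \<open>\<A>\<close> only; symmetrically for \<open>\<B>\<close>.\<close>
  have e\<A>: "mpol_eval ?e (mu A B \<A>) \<noteq> 0"
    by (rule mpol_eval_char_vec_mu[OF matchbox(1)]) (use LR in force)+
  have e\<B>: "mpol_eval ?e (mu A B \<B>) \<noteq> 0"
    by (rule mpol_eval_char_vec_mu[OF matchbox(2)]) (use LR in force)+
  \<comment> \<open>Columns alone decide here: all of \<open>\<A>\<close> belongs to the merge, and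
    an edge of \<open>\<B>\<close> in a column of the merge is the edge of \<open>\<B>\<close> that
    the merge has there.\<close>
  have eC: "mpol_eval ?e (mu A B ?C) \<noteq> 0"
  proof (rule mpol_eval_char_vec_mu[OF matchbox(3)])
    show "?C \<subseteq> \<A> \<union> \<B>" by (auto simp: merge_eq[OF L R])
    fix l assume l: "l \<in> \<A> \<union> \<B>" "col_of l \<in> col_of ` ?C"
    show "l \<in> ?C"
    proof (cases "l \<in> \<A>")
      case False
      then have "l \<in> \<B>" using l by simp
      obtain k where k: "k \<in> ?C" "col_of k = col_of l" using l(2) by force
      then have "k \<in> \<B>" using LR[OF _ \<open>l \<in> \<B>\<close>] by (auto simp: merge_eq[OF L R])
      then have "k = l" using k(2) \<open>l \<in> \<B>\<close> R by (auto simp: right_matchbox_iff dest: inj_onD)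
      then show ?thesis using k(1) by simp
    qed (simp add: merge_eq[OF L R])
  qed
  have dvd: "mu A B \<A> dvd f" "mu A B \<B> dvd f" "mu A B ?C dvd f"
    using assms(3) by (auto simp: is_LCM_def)
  \<comment> \<open>The product is a common multiple, hence a multiple of \<open>f\<close>; its
    nonzero value at the characteristic vector passes to \<open>f\<close> and shows that
    \<open>f\<close> is not the zero polynomial.\<close>
  have "f dvd mu A B \<A> * mu A B \<B> * mu A B ?C"
    using assms(3) by (simp add: is_LCM_def)
  then have ef: "mpol_eval ?e f \<noteq> 0"
    by (rule mpol_eval_nonzero_if_dvd) (use e\<A> e\<B> eC in \<open>simp add: mpol_eval_mult\<close>)
  then have f0: "f \<noteq> 0" by auto
  have rank_eval: "vec_space.rank m (map_mat (mpol_eval a) A) = card \<A>"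
    "vec_space.rank m (map_mat (mpol_eval a) B) = card \<B>"
    "vec_space.rank m (map_mat (mpol_eval a) M) + common_verts A B \<A> \<B> = card \<A> + card \<B>"
    if "mpol_eval a f \<noteq> 0" for a
  proof -
    have nz: "mpol_eval a g \<noteq> 0" if "g dvd f" for g
      using that \<open>mpol_eval a f \<noteq> 0\<close> by (rule mpol_eval_nonzero_if_dvd)
    show "vec_space.rank m (map_mat (mpol_eval a) A) = card \<A>"
      "vec_space.rank m (map_mat (mpol_eval a) B) = card \<B>"
      "vec_space.rank m (map_mat (mpol_eval a) M) + common_verts A B \<A> \<B> = card \<A> + card \<B>"
      by (rule rank_optimal_pair[OF assms(2) comm_ring_hom_mpol_eval nz nz nz, OF dvd])+
  qed
  have "bip_reduces N (bip_subst A B ?e)" if mem: "N \<in> bip_family A B f" for N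
  proof -
    obtain a where N: "N = bip_subst A B a" and a: "mpol_eval a f \<noteq> 0"
      using mem by (auto simp: bip_family_def)
    show ?thesis unfolding N bip_subst_def
      by (rule bip_reduces_if_equal_ranks[of _ m p _ q])
         (use A_carrier B_carrier rank_eval[OF a] rank_eval[OF ef] in \<open>auto simp: map_mat_bip_mat[OF A_carrier B_carrier, symmetric]\<close>)
  qed
  moreover have "bip_subst A B ?e \<in> bip_family A B f"
    using ef by (auto simp: bip_family_def)
  moreover have "\<exists>r s t. r = common_verts A B \<A> \<B> \<and> card \<A> = r + s \<and> card \<B> = r + t \<and>
       canonical_up_to_perm m p q r s t (bip_subst A B ?e) \<and>
       r + s = rank_K A \<and> r + t = rank_K B \<and> r + s + t = rank_K (bip_mat A B)"
  proof -
    \<comment> \<open>The truncated differences are exact, since \<open>v\<close> is at most the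
      size of either matchbox.\<close>
    define r s t where "r = common_verts A B \<A> \<B>" and "s = card \<A> - r" and "t = card \<B> - r"
    have s: "card \<A> = r + s" and t: "card \<B> = r + t"
      using common_verts_le[OF L R] by (simp_all add: r_def s_def t_def)
    have nz: "Fract g 1 \<noteq> 0" if "g dvd f" for g
      using that f0 by (auto simp: Zero_fract_def eq_fract)
    note rank_K = rank_optimal_pair[OF assms(2) comm_ring_hom_Fract nz nz nz, OF dvd]
    have "rank_K A = r + s" "rank_K B = r + t" "rank_K M = r + s + t"
      using rank_K s t A_carrier B_carrier M_carrier r_def by (simp_all add: rank_K_def)
    then show ?thesis
      using s t r_def canonical_up_to_perm_char_vec[OF L R r_def s t] by metis
  qed
  ultimately show ?thesis using f0 by blast
qed

end
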